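(* Let $d=1$, $p>1$ and $q\ge0$. For $m>q$ let $u_{c,m}$ be the non-increasing solution of (FBP$_m$) if $q<p-1$, respectively of (P$_m$) if $q\ge p-1$, and let $u_{c,\infty}$ be the non-increasing solution of (FBP$_\infty$) if $q<p-1$, respectively of (P$_\infty$) if $q\ge p-1$. When $q<p-1$, let $R_m$ and $R_\infty$ be the free boundary points of $u_{c,m}$ and $u_{c,\infty}$. Then, as $m\to\infty$, $$u_{c,m}(r)\to u_{c,\infty}(r)\quad\text{for every } r>0,\qquad C_{q,m,p}\to C_{q,\infty,p}.$$ Moreover, if $q<p-1$, then $R_m\to R_\infty$ as $m\to\infty$.
   Context: With $d=1$ and $'=d/dr$, the problems are as follows. (FBP$_m$): $(|u'|^{p-2}u')'+u^m=u^q$ for $0<r<R_m$, $u'(0)=0$, $u(R_m)=u'(R_m)=0$, with $u>0$ on $[0,R_m)$ and $u=0$ for $r\ge R_m$. (P$_m$): $u>0$, $(|u'|^{p-2}u')'+u^m=u^q$ for $0<r<\infty$, $u'(0)=0$, $\lim_{r\to\infty}u(r)=0$. (FBP$_\infty$): $(|u'|^{p-2}u')'=u^q$ for $0<r<R_\infty$, $u(0)=1$, $u(R_\infty)=u'(R_\infty)=0$, with $u>0$ on $[0,R_\infty)$ and $u=0$ for $r\ge R_\infty$. (P$_\infty$): $u>0$, $(|u'|^{p-2}u')'=u^q$ for $0<r<\infty$, $u(0)=1$, $\lim_{r\to\infty}u(r)=0$. The free boundary points are part of the unknowns; each problem has a unique non-increasing solution. $C_{q,m,p}$ is the smallest constant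 $C$ in $\|u\|_{L^{m+1}(\mathbb{R})}\le C\|u\|_{L^{q+1}(\mathbb{R})}^{1-\theta}\|u'\|_{L^p(\mathbb{R})}^{\theta}$ with $\theta=\frac{p(m-q)}{(m+1)[p+(p-1)(q+1)]}$, and $C_{q,\infty,p}$ is the smallest constant $C$ in $\|u\|_{L^{\infty}(\mathbb{R})}\le C\|u\|_{L^{q+1}(\mathbb{R})}^{1-\theta}\|u'\|_{L^p(\mathbb{R})}^{\theta}$ with $\theta=\frac{p}{p+(p-1)(q+1)}$, in each case over all $u\in L^{q+1}(\mathbb{R})$ with $u'\in L^p(\mathbb{R})$. *)

theory Defs
  imports "HOL-Analysis.Analysis" "HOL-Probability.Essential_Supremum"
begin

section \<open>The one-dimensional p-Laplacian problems\<close>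

text \<open>The product below is 0 where the derivative of \<open>u\<close> vanishes, for every \<open>p\<close>,
  because \<open>0 powr a = 0\<close>.\<close>

definition plap_flux :: "real \<Rightarrow> (real \<Rightarrow> real) \<Rightarrow> real \<Rightarrow> real" where
  "plap_flux p u = (\<lambda>r. \<bar>deriv u r\<bar> powr (p - 2) * deriv u r)"

definition plap :: "real \<Rightarrow> (real \<Rightarrow> real) \<Rightarrow> real \<Rightarrow> real" where
  "plap p u r = deriv (plap_flux p u) r"

text \<open>Functions of the radial variable are total functions on the reals of which only the
  restriction to \<open>{0..}\<close> matters. Solutions are classical: they are continuous up to \<open>r = 0\<close>, and
  they and their flux are differentiable at the points where the equation is imposed.\<close>

definition plap_regular :: "real \<Rightarrow> (real \<Rightarrow> real) \<Rightarrow> real set \<Rightarrow> bool" where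
  "plap_regular p u I \<longleftrightarrow> continuous_on {0..} u \<and>
     (\<forall>r\<in>I. u differentiable (at r) \<and> plap_flux p u differentiable (at r))"

definition free_boundary_at :: "(real \<Rightarrow> real) \<Rightarrow> real \<Rightarrow> bool" where
  "free_boundary_at u R \<longleftrightarrow> 0 < R \<and> u R = 0 \<and> (u has_real_derivative 0) (at R) \<and>
     (\<forall>r\<in>{0..<R}. 0 < u r) \<and> (\<forall>r\<ge>R. u r = 0)"

definition FBP :: "real \<Rightarrow> real \<Rightarrow> real \<Rightarrow> (real \<Rightarrow> real) \<Rightarrow> real \<Rightarrow> bool" where
  "FBP p q m u R \<longleftrightarrow> plap_regular p u {0<..<R} \<and>
     (\<forall>r\<in>{0<..<R}. plap p u r + u r powr m = u r powr q) \<and>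
     (u has_real_derivative 0) (at 0 within {0..}) \<and>
     free_boundary_at u R"

definition Prob :: "real \<Rightarrow> real \<Rightarrow> real \<Rightarrow> (real \<Rightarrow> real) \<Rightarrow> bool" where
  "Prob p q m u \<longleftrightarrow> plap_regular p u {0<..} \<and>
     (\<forall>r>0. 0 < u r) \<and>
     (\<forall>r>0. plap p u r + u r powr m = u r powr q) \<and>
     (u has_real_derivative 0) (at 0 within {0..}) \<and>
     (u \<longlongrightarrow> 0) at_top"

definition FBP_inf :: "real \<Rightarrow> real \<Rightarrow> (real \<Rightarrow> real) \<Rightarrow> real \<Rightarrow> bool" where
  "FBP_inf p q u R \<longleftrightarrow> plap_regular p u {0<..<R} \<and>
     (\<forall>r\<in>{0<..<R}. plap p u r = u r powr q) \<and>
     u 0 = 1 \<and>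
     free_boundary_at u R"

definition Prob_inf :: "real \<Rightarrow> real \<Rightarrow> (real \<Rightarrow> real) \<Rightarrow> bool" where
  "Prob_inf p q u \<longleftrightarrow> plap_regular p u {0<..} \<and>
     (\<forall>r>0. 0 < u r) \<and>
     (\<forall>r>0. plap p u r = u r powr q) \<and>
     u 0 = 1 \<and>
     (u \<longlongrightarrow> 0) at_top"

section \<open>Best Gagliardo--Nirenberg constants on the real line\<close>

definition in_Lp :: "real \<Rightarrow> (real \<Rightarrow> real) \<Rightarrow> bool" where
  "in_Lp s f \<longleftrightarrow> f \<in> borel_measurable lebesgue \<and> integrable lebesgue (\<lambda>x. \<bar>f x\<bar> powr s)"

text \<open>Meaningful only together with \<open>in_Lp s f\<close>.\<close>

definition Lp_norm :: "real \<Rightarrow> (real \<Rightarrow> real) \<Rightarrow> real" where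
  "Lp_norm s f = (\<integral>x. \<bar>f x\<bar> powr s \<partial>lebesgue) powr (1 / s)"

definition test_function :: "(real \<Rightarrow> real) \<Rightarrow> bool" where
  "test_function \<phi> \<longleftrightarrow> (\<forall>n x. ((deriv ^^ n) \<phi>) differentiable (at x)) \<and>
     (\<exists>a b. \<forall>x. x \<notin> {a..b} \<longrightarrow> \<phi> x = 0)"

definition weak_deriv :: "(real \<Rightarrow> real) \<Rightarrow> (real \<Rightarrow> real) \<Rightarrow> bool" where
  "weak_deriv u g \<longleftrightarrow>
     (\<forall>a b. u absolutely_integrable_on {a..b} \<and> g absolutely_integrable_on {a..b}) \<and>
     (\<forall>\<phi>. test_function \<phi> \<longrightarrow>
        (\<integral>x. u x * deriv \<phi> x \<partial>lebesgue) = - (\<integral>x. g x * \<phi> x \<partial>lebesgue))"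

definition GN_theta :: "real \<Rightarrow> real \<Rightarrow> real \<Rightarrow> real" where
  "GN_theta q m p = p * (m - q) / ((m + 1) * (p + (p - 1) * (q + 1)))"

definition GN_theta_inf :: "real \<Rightarrow> real \<Rightarrow> real" where
  "GN_theta_inf q p = p / (p + (p - 1) * (q + 1))"

definition GN_const :: "real \<Rightarrow> real \<Rightarrow> real \<Rightarrow> real" where
  "GN_const q m p = (LEAST C. \<forall>u g. in_Lp (q + 1) u \<and> weak_deriv u g \<and> in_Lp p g \<longrightarrow>
     in_Lp (m + 1) u \<and>
     Lp_norm (m + 1) u \<le>
       C * Lp_norm (q + 1) u powr (1 - GN_theta q m p) * Lp_norm p g powr GN_theta q m p)"

text \<open>The essential supremum is taken in the extended reals, so the inequality includes the
  membership of \<open>u\<close> in the space of essentially bounded functions.\<close>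

definition GN_const_inf :: "real \<Rightarrow> real \<Rightarrow> real" where
  "GN_const_inf q p = (LEAST C. \<forall>u g. in_Lp (q + 1) u \<and> weak_deriv u g \<and> in_Lp p g \<longrightarrow>
     esssup lebesgue (\<lambda>x. ereal \<bar>u x\<bar>) \<le>
       ereal (C * Lp_norm (q + 1) u powr (1 - GN_theta_inf q p) * Lp_norm p g powr GN_theta_inf q p))"

end

theory Submission
  imports Defs
begin

text \<open>The energy \<open>(p - 1)/p |u'|^p - F(u)\<close>, with \<open>F\<close> the primitive of the right-hand side vanishing at 0, is constant, and
  it is zero because \<open>u\<close> and \<open>u'\<close> vanish together at the free boundary or at infinity. Hence
  \<open>u' = - c u^((q+1)/p) (1 - (u/a)^(m-q))^(1/p)\<close> with \<open>a = u(0) = ((m+1)/(q+1))^(1/(m-q)) \<rightarrow> 1\<close>, while \<open>u_\<infinity>\<close>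
  satisfies the same equation without the last factor. That factor is at most 1, and tends to 1
  uniformly on \<open>[r0, \<infinity>)\<close> for each \<open>r0 > 0\<close>; separating variables and letting \<open>r0 \<rightarrow> 0\<close> gives the
  convergence of \<open>u_m\<close> and \<open>R_m\<close>.

  For the constants no extremal function is needed. Interpolating \<open>L^(m+1)\<close> between \<open>L^(q+1)\<close> and
  \<open>L^\<infinity>\<close> gives \<open>C_m \<le> C_\<infinity>^((m-q)/(m+1))\<close>, and testing with a fixed function that is nearly
  optimal for \<open>C_\<infinity>\<close> gives the lower bound, because its \<open>L^(m+1)\<close> norms tend to its \<open>L^\<infinity>\<close> norm.\<close>

section \<open>Smooth functions\<close>

text \<open>Weak derivatives are given only by duality with test functions, so all information on a
  competitor has to be extracted from smooth functions of compact support; these are therefore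
  constructed explicitly. A crude inequality with constant 4 is enough for the best constants to
  exist: it makes the set of valid constants nonempty, and closedness together with a lower bound
  does the rest.

  For the solutions the obstacle is the maximum. There the first-order equation degenerates: the
  constant \<open>a\<close> solves it too, and nothing in it forces \<open>u\<close> to leave
  \<open>a\<close>. A plateau is excluded by the second-order equation, because
  \<open>a powr q\<close> and \<open>a powr m\<close> differ. A departure at a speed independent of
  \<open>m\<close> then follows from \<open>(u/a) powr (m - q) \<le> u/a\<close>; the uniform
  control away from 0 rests on it. The cases with and without a free boundary are treated together:
  after separation of variables they differ only in whether the new variable \<open>Psi\<close>
  extends continuously to the value 0 of the solution.\<close>

definition smooth :: "(real \<Rightarrow> real) \<Rightarrow> bool" where
  "smooth f \<longleftrightarrow> (\<forall>n x. ((deriv ^^ n) f) differentiable (at x))"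

lemma smooth_Suc: "smooth f \<longleftrightarrow> (\<forall>x. f differentiable (at x)) \<and> smooth (deriv f)"
proof -
  have "(\<forall>n x. ((deriv ^^ n) f) differentiable (at x)) \<longleftrightarrow>
     (\<forall>x. f differentiable (at x)) \<and> (\<forall>n x. ((deriv ^^ Suc n) f) differentiable (at x))"
    by (metis funpow_0 not0_implies_Suc)
  then show ?thesis
    by (simp add: smooth_def funpow_Suc_right del: funpow.simps)
qed

lemma smooth_differentiable: "smooth f \<Longrightarrow> f differentiable (at x)"
  and smooth_deriv: "smooth f \<Longrightarrow> smooth (deriv f)"
  using smooth_Suc by blast+

lemma smooth_DERIV: "smooth f \<Longrightarrow> (f has_real_derivative deriv f x) (at x)"
  by (simp add: DERIV_deriv_iff_real_differentiable smooth_differentiable)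

lemma smooth_isCont: "smooth f \<Longrightarrow> isCont f x"
  using smooth_DERIV DERIV_isCont by blast

lemma smooth_continuous_on: "smooth f \<Longrightarrow> continuous_on A f"
  by (simp add: continuous_at_imp_continuous_on smooth_isCont)

lemma smooth_if_DERIV: "(\<And>x. (f has_real_derivative f' x) (at x)) \<Longrightarrow> smooth f' \<Longrightarrow> smooth f"
  by (metis (full_types) DERIV_imp_deriv ext real_differentiable_def smooth_Suc)

text \<open>If a class of functions is closed under differentiation, induction keeps every iterated
  derivative in the class. The work in each use lies in choosing a class that is large enough to be
  closed.\<close>

lemma smooth_coinduct:
  assumes "P f" and "\<And>f. P f \<Longrightarrow> \<exists>f'. P f' \<and> (\<forall>x. (f has_real_derivative f' x) (at x))"
  shows "smooth f"
proof -
  have "P ((deriv ^^ n) f)" for n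
  proof (induction n)
    case (Suc n)
    then obtain f' where "P f'" "\<forall>x. ((deriv ^^ n) f has_real_derivative f' x) (at x)"
      using assms(2) by blast
    moreover from this have "deriv ((deriv ^^ n) f) = f'"
      by (auto intro!: ext DERIV_imp_deriv)
    ultimately show ?case by simp
  qed (simp add: assms(1))
  then show ?thesis
    unfolding smooth_def using assms(2) real_differentiable_def by blast
qed

lemma smooth_const: "smooth (\<lambda>x. c)"
  by (rule smooth_coinduct[where P = "\<lambda>f. \<exists>c. f = (\<lambda>x. c)"]) (auto intro!: exI[of _ "\<lambda>x. 0"] derivative_eq_intros)

lemma smooth_add:
  assumes "smooth f" "smooth g" shows "smooth (\<lambda>x. f x + g x)"
proof (rule smooth_coinduct[where P = "\<lambda>h. \<exists>f g. smooth f \<and> smooth g \<and> h = (\<lambda>x. f x + g x)"])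
  fix h :: "real \<Rightarrow> real" assume "\<exists>f g. smooth f \<and> smooth g \<and> h = (\<lambda>x. f x + g x)"
  then obtain f g where "smooth f" "smooth g" and h: "h = (\<lambda>x. f x + g x)" by blast
  then show "\<exists>h'. (\<exists>f g. smooth f \<and> smooth g \<and> h' = (\<lambda>x. f x + g x)) \<and>
      (\<forall>x. (h has_real_derivative h' x) (at x))"
    unfolding h by (intro exI[of _ "\<lambda>x. deriv f x + deriv g x"])
      (auto intro!: DERIV_add smooth_DERIV dest: smooth_deriv)
qed (use assms in blast)

text \<open>Products of two smooth functions are not closed under differentiation, finite sums of them are.\<close>

lemma smooth_mult:
  assumes "smooth f" "smooth g" shows "smooth (\<lambda>x. f x * g x)"
proof -
  let ?P = "\<lambda>h. \<exists>fs. (\<forall>(f, g)\<in>set fs. smooth f \<and> smooth g) \<and> h = (\<lambda>x. \<Sum>(f, g)\<leftarrow>fs. f x * g x)"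
  show ?thesis
  proof (rule smooth_coinduct[where P = ?P])
    show "?P (\<lambda>x. f x * g x)"
      by (rule exI[of _ "[(f, g)]"]) (use assms in simp)
  next
    fix h :: "real \<Rightarrow> real" assume "?P h"
    then obtain fs where fs: "\<forall>(f, g)\<in>set fs. smooth f \<and> smooth g"
      and h: "h = (\<lambda>x. \<Sum>(f, g)\<leftarrow>fs. f x * g x)" by blast
    define gs where "gs = map (\<lambda>(f, g). (deriv f, g)) fs @ map (\<lambda>(f, g). (f, deriv g)) fs"
    have "((\<lambda>x. \<Sum>(f, g)\<leftarrow>fs. f x * g x) has_real_derivative
        (\<Sum>(f, g)\<leftarrow>map (\<lambda>(f, g). (deriv f, g)) fs @ map (\<lambda>(f, g). (f, deriv g)) fs. f x * g x)) (at x)" for x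
      using fs
    proof (induction fs)
      case (Cons a fs)
      obtain f g where a: "a = (f, g)" by (cases a)
      with Cons.prems have "smooth f" "smooth g" by auto
      then have "((\<lambda>x. f x * g x) has_real_derivative (deriv f x * g x + f x * deriv g x)) (at x)"
        by (auto intro!: derivative_eq_intros smooth_DERIV)
      from DERIV_add[OF this Cons.IH] show ?case
        using Cons.prems by (simp add: a algebra_simps)
    qed simp
    moreover have "\<forall>(f, g)\<in>set gs. smooth f \<and> smooth g"
      using fs by (auto simp: gs_def intro: smooth_deriv)
    ultimately show "\<exists>h'. ?P h' \<and> (\<forall>x. (h has_real_derivative h' x) (at x))"
      unfolding h gs_def[symmetric] by (intro exI[of _ "\<lambda>x. \<Sum>(f, g)\<leftarrow>gs. f x * g x"]) blast
  qed
qed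

text \<open>Each differentiation produces a factor \<open>k\<close>, so the class closed under
  differentiation consists of the multiples \<open>c * f (k * x + d)\<close>.\<close>

lemma smooth_affine:
  assumes "smooth f" shows "smooth (\<lambda>x. f (k * x + d))"
proof (rule smooth_coinduct[where P = "\<lambda>h. \<exists>f c. smooth f \<and> h = (\<lambda>x. c * f (k * x + d))"])
  show "\<exists>g c. smooth g \<and> (\<lambda>x. f (k * x + d)) = (\<lambda>x. c * g (k * x + d))"
    by (rule exI[of _ f], rule exI[of _ 1]) (use assms in simp)
next
  fix h :: "real \<Rightarrow> real" assume "\<exists>f c. smooth f \<and> h = (\<lambda>x. c * f (k * x + d))"
  then obtain f c where f: "smooth f" and h: "h = (\<lambda>x. c * f (k * x + d))" by blast
  have "(h has_real_derivative (c * k) * deriv f (k * x + d)) (at x)" for x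
    unfolding h by (auto intro!: derivative_eq_intros DERIV_chain2[OF smooth_DERIV[OF f]])
  then show "\<exists>h'. (\<exists>f c. smooth f \<and> h' = (\<lambda>x. c * f (k * x + d))) \<and> (\<forall>x. (h has_real_derivative h' x) (at x))"
    using f by (intro exI[of _ "\<lambda>x. (c * k) * deriv f (k * x + d)"]) (blast intro: smooth_deriv)
qed

lemma smooth_antiderivative:
  assumes "smooth f" obtains F where "smooth F" "\<And>x. (F has_real_derivative f x) (at x)"
proof -
  obtain F where "\<forall>x. - \<infinity> < ereal x \<longrightarrow> ereal x < \<infinity> \<longrightarrow> (F has_vector_derivative f x) (at x)"
    using einterval_antiderivative[of "- \<infinity>" \<infinity> f] smooth_isCont[OF assms] by auto
  then have "(F has_real_derivative f x) (at x)" for x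
    by (simp add: has_real_derivative_iff_has_vector_derivative)
  with that assms show ?thesis using smooth_if_DERIV by blast
qed

section \<open>Functions that are flat at 0, and the bumps, steps and ramps built from them\<close>

definition flat :: "real poly \<Rightarrow> real \<Rightarrow> real" where
  "flat P x = (if x > 0 then poly P (inverse x) * exp (- inverse x) else 0)"

lemma poly_exp_tendsto_0: "((\<lambda>x::real. poly P x * exp (- x)) \<longlongrightarrow> 0) at_top"
proof -
  have "((\<lambda>x. \<Sum>i\<le>degree P. coeff P i * (x ^ i / exp x)) \<longlongrightarrow> (\<Sum>i\<le>degree P. coeff P i * 0)) at_top"
    by (intro tendsto_intros tendsto_power_div_exp_0)
  then show ?thesis
    by (simp add: poly_altdef sum_distrib_right exp_minus divide_inverse mult.assoc)
qed

text \<open>Functions \<open>P(1/x) exp(-1/x)\<close>, extended by 0, form a class closed under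
  differentiation: for \<open>x > 0\<close> the derivative is
  \<open>(1/x)^2 (P - P')(1/x) exp(-1/x)\<close>, and \<open>[:0, 0, 1:]\<close> is the square of
  the variable. At 0 the exponential beats every power of \<open>1/x\<close>.\<close>

lemma DERIV_flat: "(flat P has_real_derivative flat ([:0, 0, 1:] * (P - pderiv P)) x) (at x)"
proof -
  consider "x < 0" | "x = 0" | "x > 0" by linarith
  then show ?thesis
  proof cases
    case 1
    then have "((\<lambda>x. 0) has_real_derivative 0) (at x)" "\<forall>\<^sub>F y in nhds x. flat P y = 0"
      using eventually_nhds_in_open[of "{..<0}" x] by (auto simp: flat_def elim!: eventually_mono)
    then show ?thesis
      using 1 DERIV_cong_ev[of x x "flat P" "\<lambda>x. 0" 0 0] by (simp add: flat_def)
  next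
    case 2
    have "((\<lambda>y. flat P y / y) \<longlongrightarrow> 0) (at_right 0)"
    proof (rule Lim_transform_eventually)
      \<comment> \<open>Dividing by \<open>y\<close> multiplies the polynomial in \<open>1/y\<close>
        by its variable, so the difference quotient at 0 is again covered by
        \<open>poly_exp_tendsto_0\<close>.\<close>
      show "((\<lambda>y. poly ([:0, 1:] * P) (inverse y) * exp (- inverse y)) \<longlongrightarrow> 0) (at_right 0)"
        by (rule filterlim_compose[OF poly_exp_tendsto_0 filterlim_inverse_at_top_right])
      show "\<forall>\<^sub>F y in at_right 0. poly ([:0, 1:] * P) (inverse y) * exp (- inverse y) = flat P y / y"
        by (auto simp: eventually_at_filter flat_def field_simps)
    qed
    moreover have "((\<lambda>y. flat P y / y) \<longlongrightarrow> 0) (at_left 0)"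
      by (rule tendsto_eventually) (auto simp: eventually_at_filter flat_def)
    ultimately have "((\<lambda>y. flat P y / y) \<longlongrightarrow> 0) (at 0)"
      by (rule filterlim_split_at[rotated])
    then show ?thesis
      using 2 by (simp add: has_field_derivative_iff flat_def)
  next
    case 3
    have "((\<lambda>x. poly P (inverse x) * exp (- inverse x)) has_real_derivative
        flat ([:0, 0, 1:] * (P - pderiv P)) x) (at x)"
      using 3 by (auto intro!: derivative_eq_intros DERIV_chain2[OF poly_DERIV] simp: flat_def power2_eq_square field_simps)
    moreover have "\<forall>\<^sub>F y in nhds x. flat P y = poly P (inverse y) * exp (- inverse y)"
      using 3 eventually_nhds_in_open[of "{0<..}" x] by (auto simp: flat_def elim!: eventually_mono)
    ultimately show ?thesis
      using DERIV_cong_ev[of x x "flat P" "\<lambda>x. poly P (inverse x) * exp (- inverse x)"] by simp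
  qed
qed

lemma smooth_flat: "smooth (flat P)"
  by (rule smooth_coinduct[where P = "\<lambda>f. \<exists>P. f = flat P"]) (auto intro: DERIV_flat)

definition bump :: "real \<Rightarrow> real" where
  "bump x = flat 1 x * flat 1 (- 1 * x + 1)"

lemma smooth_bump: "smooth bump"
  unfolding bump_def[abs_def] by (intro smooth_mult smooth_flat smooth_affine[OF smooth_flat])

lemma bump_nonneg: "0 \<le> bump x"
  and bump_pos: "0 < x \<Longrightarrow> x < 1 \<Longrightarrow> 0 < bump x"
  and bump_eq_0: "x \<notin> {0<..<1} \<Longrightarrow> bump x = 0"
  by (auto simp: bump_def flat_def)

lemma const_if_DERIV_0:
  fixes f :: "real \<Rightarrow> real"
  assumes "convex A" "\<And>x. x \<in> A \<Longrightarrow> (f has_real_derivative 0) (at x)" "x \<in> A" "y \<in> A"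
  shows "f x = f y"
  using has_field_derivative_zero_constant[OF assms(1), of f] assms(2-)
  by (metis has_field_derivative_at_within)

text \<open>An antiderivative of \<open>bump\<close>, shifted and rescaled. Positivity of
  \<open>bump\<close> on \<open>(0, 1)\<close> separates the two end values, so the rescaling is
  possible.\<close>

lemma smooth_step_exists:
  obtains S where "smooth S" "\<And>x. 0 \<le> S x" "\<And>x. S x \<le> 1" "\<And>x. x \<le> 0 \<Longrightarrow> S x = 0" "\<And>x. 1 \<le> x \<Longrightarrow> S x = (1::real)"
proof -
  obtain B where B: "smooth B" and dB: "\<And>x. (B has_real_derivative bump x) (at x)"
    using smooth_antiderivative[OF smooth_bump] by blast
  have mono: "B x \<le> B y" if "x \<le> y" for x y
    using DERIV_nonneg_imp_nondecreasing[OF that] dB bump_nonneg by blast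
  have l: "B x = B 0" if "x \<le> 0" for x
  proof (rule const_if_DERIV_0[of "{..0}" B])
    show "(B has_real_derivative 0) (at x)" if "x \<in> {..0}" for x
      using dB[of x] bump_eq_0[of x] that by simp
  qed (use that in auto)
  have r: "B x = B 1" if "x \<ge> 1" for x
  proof (rule const_if_DERIV_0[of "{1..}" B])
    show "(B has_real_derivative 0) (at x)" if "x \<in> {1..}" for x
      using dB[of x] bump_eq_0[of x] that by simp
  qed (use that in auto)
  have lt: "B 0 < B 1"
  proof (rule DERIV_pos_imp_increasing_open[of 0 1 B])
    show "\<exists>y. (B has_real_derivative y) (at x) \<and> 0 < y" if "0 < x" "x < 1" for x
      using dB bump_pos that by blast
  qed (use smooth_continuous_on[OF B] in auto)
  show ?thesis
  proof
    show "smooth (\<lambda>x. inverse (B 1 - B 0) * (B x + (- B 0)))"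
      by (intro smooth_mult smooth_const smooth_add B)
    fix x
    have "B 0 \<le> B x" "B x \<le> B 1"
      using l[of x] r[of x] mono[of 0 x] mono[of x 1] lt by (cases "x \<le> 0"; cases "1 \<le> x"; linarith)+
    then show "0 \<le> inverse (B 1 - B 0) * (B x + (- B 0))" "inverse (B 1 - B 0) * (B x + (- B 0)) \<le> 1"
      using lt by (auto simp: field_simps)
    show "inverse (B 1 - B 0) * (B x + (- B 0)) = 0" if "x \<le> 0"
      unfolding l[OF that] by simp
    show "inverse (B 1 - B 0) * (B x + (- B 0)) = 1" if "1 \<le> x"
      unfolding r[OF that] using lt by simp
  qed
qed

text \<open>An antiderivative of a smooth step. The offset \<open>k\<close> is what the smooth bend
  costs against a sharp corner; it cancels in the differences of shifted ramps used later.\<close>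

lemma smooth_ramp_exists:
  obtains Q S :: "real \<Rightarrow> real" and k where "smooth Q" "\<And>x. (Q has_real_derivative S x) (at x)"
    "\<And>x. 0 \<le> S x" "\<And>x. S x \<le> 1" "\<And>x. x \<le> 0 \<Longrightarrow> S x = 0" "\<And>x. 1 \<le> x \<Longrightarrow> S x = 1"
    "\<And>x. x \<le> 0 \<Longrightarrow> Q x = 0" "\<And>x. 1 \<le> x \<Longrightarrow> Q x = x - k"
    "\<And>x y. x \<le> y \<Longrightarrow> Q x \<le> Q y" "\<And>x y. x \<le> y \<Longrightarrow> Q y - Q x \<le> y - x"
proof -
  obtain S :: "real \<Rightarrow> real" where S: "smooth S" "\<And>x. 0 \<le> S x" "\<And>x. S x \<le> 1"
    "\<And>x. x \<le> 0 \<Longrightarrow> S x = 0" "\<And>x. 1 \<le> x \<Longrightarrow> S x = 1"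
    using smooth_step_exists by blast
  obtain Q0 where Q0: "smooth Q0" and dQ0: "\<And>x. (Q0 has_real_derivative S x) (at x)"
    using smooth_antiderivative[OF S(1)] by blast
  define Q where "Q = (\<lambda>x. Q0 x + (- Q0 0))"
  have Q: "smooth Q"
    unfolding Q_def by (intro smooth_add Q0 smooth_const)
  have dQ: "(Q has_real_derivative S x) (at x)" for x
    unfolding Q_def by (auto intro!: derivative_eq_intros dQ0)
  show ?thesis
  proof (rule that[of Q S "1 - Q 1", OF Q dQ S(2-5)])
    show "Q x = 0" if "x \<le> 0" for x
    proof -
      have "Q x = Q 0"
      proof (rule const_if_DERIV_0[of "{..0}" Q])
        show "(Q has_real_derivative 0) (at x)" if "x \<in> {..0}" for x
          using dQ[of x] S(4)[of x] that by simp
      qed (use that in auto)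
      then show ?thesis by (simp add: Q_def)
    qed
    show "Q x = x - (1 - Q 1)" if "1 \<le> x" for x
    proof -
      have "Q x - x = Q 1 - 1"
      proof (rule const_if_DERIV_0[of "{1..}" "\<lambda>x. Q x - x"])
        show "((\<lambda>x. Q x - x) has_real_derivative 0) (at x)" if "x \<in> {1..}" for x
          using DERIV_diff[OF dQ[of x] DERIV_ident] S(5)[of x] that by simp
      qed (use that in auto)
      then show ?thesis by simp
    qed
    show "Q x \<le> Q y" if "x \<le> y" for x y
      using DERIV_nonneg_imp_nondecreasing[OF that] dQ S(2) by blast
    show "Q y - Q x \<le> y - x" if "x \<le> y" for x y
    proof -
      have "(\<lambda>x. x - Q x) x \<le> (\<lambda>x. x - Q x) y"
      proof (rule DERIV_nonneg_imp_nondecreasing[OF that])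
        show "\<exists>z. ((\<lambda>x. x - Q x) has_real_derivative z) (at w) \<and> 0 \<le> z" for w
          using DERIV_diff[OF DERIV_ident dQ[of w]] S(3)[of w] by force
      qed
      then show ?thesis by simp
    qed
  qed
qed

section \<open>The Gagliardo--Nirenberg inequality for the supremum\<close>

lemma test_function_iff: "test_function \<phi> \<longleftrightarrow> smooth \<phi> \<and> (\<exists>a b. \<forall>x. x \<notin> {a..b} \<longrightarrow> \<phi> x = 0)"
  by (simp add: test_function_def smooth_def)

lemma smooth_measurable: "smooth f \<Longrightarrow> f \<in> borel_measurable lebesgue"
  by (rule measurable_completion) (simp add: borel_measurable_continuous_onI smooth_continuous_on)

lemma AE_lebesgue_singleton: "AE x in lebesgue. x \<noteq> (c::real)"
  by (rule AE_completion[OF AE_lborel_singleton])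

lemma AE_lebesgue_negligible: "negligible N \<Longrightarrow> AE x in lebesgue. x \<notin> N"
  by (rule AE_not_in) (simp add: negligible_iff_null_sets)

text \<open>For large \<open>n\<close> both arguments of \<open>S\<close> lie outside
  \<open>(0, 1)\<close>, so the sequence is eventually constant. The point \<open>a\<close> is left
  out because the first argument is 0 there for every \<open>n\<close>, and \<open>S\<close>
  vanishes at 0.\<close>

lemma ramp_difference_tendsto:
  fixes S :: "real \<Rightarrow> real"
  assumes S: "\<And>x. x \<le> 0 \<Longrightarrow> S x = 0" "\<And>x. 1 \<le> x \<Longrightarrow> S x = 1" and h: "h > 0" and x: "x \<noteq> a"
  shows "(\<lambda>n. S (real (Suc n) * (x - a)) - S (real (Suc n) * (x - (a + h)))) \<longlonglongrightarrow> indicator {a..a + h} x"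
proof (rule tendsto_eventually)
  have big: "\<forall>\<^sub>F n in sequentially. 1 \<le> real (Suc n) * d" if "d > 0" for d
  proof -
    have "\<forall>\<^sub>F n in sequentially. inverse (real (Suc n)) < d"
      using order_tendstoD(2)[OF LIMSEQ_inverse_real_of_nat that] .
    then show ?thesis
      by (rule eventually_mono) (simp add: field_simps)
  qed
  consider "x < a" | "a < x" "x \<le> a + h" | "a + h < x" using x by linarith
  then show "\<forall>\<^sub>F n in sequentially. S (real (Suc n) * (x - a)) - S (real (Suc n) * (x - (a + h))) = indicator {a..a + h} x"
  proof cases
    case 1
    then show ?thesis
      using h by (auto simp: S(1) mult_nonneg_nonpos simp del: of_nat_Suc)
  next
    case 2
    have "\<forall>\<^sub>F n in sequentially. 1 \<le> real (Suc n) * (x - a)"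
      using 2 by (intro big) simp
    then show ?thesis
      by (rule eventually_mono) (use 2 in \<open>simp add: S mult_nonneg_nonpos del: of_nat_Suc\<close>)
  next
    case 3
    have "\<forall>\<^sub>F n in sequentially. 1 \<le> real (Suc n) * (x - (a + h))"
      using 3 by (intro big) simp
    then show ?thesis
    proof (rule eventually_mono)
      fix n assume *: "1 \<le> real (Suc n) * (x - (a + h))"
      also have "\<dots> \<le> real (Suc n) * (x - a)"
        using h by (intro mult_left_mono) auto
      finally show "S (real (Suc n) * (x - a)) - S (real (Suc n) * (x - (a + h))) = indicator {a..a + h} x"
        using * 3 by (simp add: S(2))
    qed
  qed
qed

text \<open>Test functions whose derivatives tend to the difference of the indicators of
  \<open>{a..a + h}\<close> and \<open>{c..c + h}\<close> produce the difference of the integrals in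
  the limit. They are bounded by \<open>h\<close> and supported in \<open>{a..b}\<close>, which
  bounds the other side of the duality.\<close>

lemma weak_deriv_interval_averages:
  assumes wd: "weak_deriv u g" and h: "0 < h" and ac: "a < c" and cb: "c + h < b"
  shows "\<bar>integral {a..a + h} u - integral {c..c + h} u\<bar> \<le> h * integral {a..b} (\<lambda>x. \<bar>g x\<bar>)"
proof -
  obtain Q S :: "real \<Rightarrow> real" and k where Q: "smooth Q" "\<And>x. (Q has_real_derivative S x) (at x)"
    and S: "\<And>x. 0 \<le> S x" "\<And>x. S x \<le> 1" "\<And>x. x \<le> 0 \<Longrightarrow> S x = 0" "\<And>x. 1 \<le> x \<Longrightarrow> S x = 1"
    and Q0: "\<And>x. x \<le> 0 \<Longrightarrow> Q x = 0" and Q1: "\<And>x. 1 \<le> x \<Longrightarrow> Q x = x - k"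
    and Qmono: "\<And>x y. x \<le> y \<Longrightarrow> Q x \<le> Q y" and QL: "\<And>x y. x \<le> y \<Longrightarrow> Q y - Q x \<le> y - x"
    using smooth_ramp_exists by blast
  have iu: "set_integrable lebesgue {a..b} u" and ig: "set_integrable lebesgue {a..b} g"
    using wd by (auto simp: weak_deriv_def)
  define D where "D = (\<lambda>n d x. S (real (Suc n) * (x - d)) - S (real (Suc n) * (x - (d + h))))"
  define q where "q = (\<lambda>n d x. Q (real (Suc n) * (x - d)) - Q (real (Suc n) * (x - (d + h))))"
  \<comment> \<open>Both terms climb to the same height \<open>real (Suc n) * h\<close>, one from
    \<open>a\<close> and one from \<open>c\<close>, so their difference returns to 0 and has compact
    support. The factor in front normalises the height to \<open>h\<close>.\<close>
  define \<phi> where "\<phi> = (\<lambda>n x. inverse (real (Suc n)) * (q n a x - q n c x))"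
  have dq: "(q n d has_real_derivative real (Suc n) * D n d x) (at x)" for n d x
    unfolding q_def D_def
    by (rule derivative_eq_intros DERIV_chain2[OF Q(2)] refl)+ (simp add: algebra_simps)
  have d\<phi>: "(\<phi> n has_real_derivative (D n a x - D n c x)) (at x)" for n x
    unfolding \<phi>_def by (rule derivative_eq_intros dq refl)+ (simp add: field_simps)
  have sq: "smooth (q n d)" for n d
  proof -
    have "smooth (\<lambda>x. Q (real (Suc n) * x + (- real (Suc n) * d)) + (-1) * Q (real (Suc n) * x + (- real (Suc n) * (d + h))))"
      by (intro smooth_add smooth_mult smooth_const smooth_affine Q)
    moreover have "(\<lambda>x. Q (real (Suc n) * x + (- real (Suc n) * d)) + (-1) * Q (real (Suc n) * x + (- real (Suc n) * (d + h)))) = q n d"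
      by (rule ext) (simp add: q_def algebra_simps del: of_nat_Suc)
    ultimately show ?thesis by simp
  qed
  have s\<phi>: "smooth (\<phi> n)" for n
  proof -
    have "smooth (\<lambda>x. inverse (real (Suc n)) * (q n a x + (-1) * q n c x))"
      by (intro smooth_add smooth_mult smooth_const sq)
    then show ?thesis by (simp add: \<phi>_def)
  qed
  have deriv\<phi>: "deriv (\<phi> n) = (\<lambda>x. D n a x - D n c x)" for n
    using d\<phi> by (intro ext DERIV_imp_deriv)
  have qb: "0 \<le> q n d x" "q n d x \<le> real (Suc n) * h" for n d x
  proof -
    have "real (Suc n) * (x - (d + h)) \<le> real (Suc n) * (x - d)"
      using h by (intro mult_left_mono) auto
    from Qmono[OF this] QL[OF this] show "0 \<le> q n d x" "q n d x \<le> real (Suc n) * h"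
      by (auto simp: q_def algebra_simps)
  qed
  have \<phi>b: "\<bar>\<phi> n x\<bar> \<le> h" for n x
  proof -
    have "\<bar>q n a x - q n c x\<bar> \<le> real (Suc n) * h"
      using qb[of n a x] qb[of n c x] by linarith
    then show ?thesis
      unfolding \<phi>_def by (simp add: abs_mult field_simps)
  qed
  have Db: "\<bar>D n a x - D n c x\<bar> \<le> 2" for n x
    unfolding D_def using S(1,2) by (smt (verit))
  \<comment> \<open>From this index on the last ramp, which bends at \<open>c + h\<close> over a
    width \<open>1 / real (Suc n)\<close>, is finished before \<open>b\<close>.\<close>
  define n0 where "n0 = nat \<lceil>1 / (b - (c + h))\<rceil>"
  have supp: "\<phi> n x = 0 \<and> D n a x - D n c x = 0" if n: "n \<ge> n0" and x: "x \<notin> {a..b}" for n x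
  proof (cases "x < a")
    case True
    then show ?thesis
      using ac h by (simp add: \<phi>_def q_def D_def Q0 S(3) mult_nonneg_nonpos del: of_nat_Suc)
  next
    case False
    then have xb: "b < x" using x by auto
    have "1 / (b - (c + h)) \<le> real (Suc n)"
      using n by (simp add: n0_def)
    then have "1 \<le> real (Suc n) * (b - (c + h))"
      using cb by (simp add: field_simps)
    also have "\<dots> \<le> real (Suc n) * (x - (c + h))"
      using xb by (intro mult_left_mono) auto
    finally have 1: "1 \<le> real (Suc n) * (x - (c + h))" .
    have far: "Q (real (Suc n) * (x - e)) = real (Suc n) * (x - e) - k" "S (real (Suc n) * (x - e)) = 1"
      if "e \<le> c + h" for e
    proof -
      have "real (Suc n) * (x - (c + h)) \<le> real (Suc n) * (x - e)"
        using that by (intro mult_left_mono) auto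
      with 1 have "1 \<le> real (Suc n) * (x - e)" by linarith
      then show "Q (real (Suc n) * (x - e)) = real (Suc n) * (x - e) - k" "S (real (Suc n) * (x - e)) = 1"
        by (rule Q1, rule S(4))
    qed
    have "q n a x = real (Suc n) * h" "q n c x = real (Suc n) * h" "D n a x = 0" "D n c x = 0"
      using ac h by (simp_all only: q_def D_def far) (simp_all add: algebra_simps)
    then show ?thesis
      by (simp add: \<phi>_def)
  qed
  have test: "test_function (\<phi> n)" if "n \<ge> n0" for n
    unfolding test_function_iff using s\<phi> supp[OF that] by blast
  have bound: "\<bar>\<integral>x. u x * deriv (\<phi> n) x \<partial>lebesgue\<bar> \<le> h * integral {a..b} (\<lambda>x. \<bar>g x\<bar>)" if n: "n \<ge> n0" for n
  proof -
    have i: "integrable lebesgue (\<lambda>x. h * (indicator {a..b} x * \<bar>g x\<bar>))"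
      using set_integrable_abs[OF ig] by (simp add: set_integrable_def)
    have le: "\<bar>g x * \<phi> n x\<bar> \<le> h * (indicator {a..b} x * \<bar>g x\<bar>)" for x
      using mult_left_mono[OF \<phi>b[of n x], of "\<bar>g x\<bar>"] supp[OF n, of x] by (auto simp: indicator_def abs_mult mult.commute)
    have "integrable lebesgue (\<lambda>x. g x * \<phi> n x)"
    proof (rule Bochner_Integration.integrable_bound[OF i])
      \<comment> \<open>\<open>weak_deriv\<close> makes \<open>g\<close> integrable on bounded
        intervals only; measurability of the product on the line is obtained by cutting
        \<open>g\<close> off outside \<open>{a..b}\<close>, where \<open>\<phi> n\<close>
        vanishes.\<close>
      have "(\<lambda>x. (indicator {a..b} x *\<^sub>R g x) * \<phi> n x) \<in> borel_measurable lebesgue"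
        using ig smooth_measurable[OF s\<phi>, of n] by (intro borel_measurable_times) (auto simp: set_integrable_def)
      moreover have "(indicator {a..b} x *\<^sub>R g x) * \<phi> n x = g x * \<phi> n x" for x
        using supp[OF n, of x] by (cases "x \<in> {a..b}") auto
      ultimately show "(\<lambda>x. g x * \<phi> n x) \<in> borel_measurable lebesgue"
        by (simp only:)
    next
      show "AE x in lebesgue. norm (g x * \<phi> n x) \<le> norm (h * (indicator {a..b} x * \<bar>g x\<bar>))"
        by (rule AE_I2) (use le order_trans[OF le abs_ge_self] in simp)
    qed
    then have "norm (\<integral>x. g x * \<phi> n x \<partial>lebesgue) \<le> (\<integral>x. h * (indicator {a..b} x * \<bar>g x\<bar>) \<partial>lebesgue)"
      using le by (intro Bochner_Integration.integral_norm_bound_integral i) auto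
    also have "\<dots> = h * integral {a..b} (\<lambda>x. \<bar>g x\<bar>)"
      using set_lebesgue_integral_eq_integral(2)[OF set_integrable_abs[OF ig]]
      by (simp add: set_lebesgue_integral_def)
    finally show ?thesis
      using wd test[OF n] by (simp add: weak_deriv_def)
  qed
  have "(\<lambda>n. \<integral>x. u x * deriv (\<phi> (n + n0)) x \<partial>lebesgue) \<longlonglongrightarrow>
      (\<integral>x. u x * (indicator {a..a + h} x - indicator {c..c + h} x) \<partial>lebesgue)"
  proof (rule integral_dominated_convergence[where w = "\<lambda>x. 2 * (indicator {a..b} x * \<bar>u x\<bar>)"])
    have int: "integrable lebesgue (\<lambda>x. u x * indicator {d..d + h} x)" if "a \<le> d" "d + h \<le> b" for d
      using set_integrable_subset[OF iu, of "{d..d + h}"] that by (simp add: set_integrable_def mult.commute)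
    have int2: "integrable lebesgue (\<lambda>x. u x * (indicator {a..a + h} x - indicator {c..c + h} x))"
      unfolding right_diff_distrib using ac cb by (intro Bochner_Integration.integrable_diff int) auto
    then show "(\<lambda>x. u x * (indicator {a..a + h} x - indicator {c..c + h} x)) \<in> borel_measurable lebesgue"
      by blast
    show "integrable lebesgue (\<lambda>x. 2 * (indicator {a..b} x * \<bar>u x\<bar>))"
      using set_integrable_abs[OF iu] by (simp add: set_integrable_def)
    fix n
    have "(\<lambda>x. (indicator {a..b} x *\<^sub>R u x) * deriv (\<phi> (n + n0)) x) \<in> borel_measurable lebesgue"
      using iu smooth_measurable[OF smooth_deriv[OF s\<phi>], of "n + n0"]
      by (intro borel_measurable_times) (auto simp: set_integrable_def)
    moreover have "(indicator {a..b} x *\<^sub>R u x) * deriv (\<phi> (n + n0)) x = u x * deriv (\<phi> (n + n0)) x" for x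
      using supp[of "n + n0" x] unfolding deriv\<phi> by (cases "x \<in> {a..b}") auto
    ultimately show "(\<lambda>x. u x * deriv (\<phi> (n + n0)) x) \<in> borel_measurable lebesgue"
      by (simp only:)
    show "AE x in lebesgue. norm (u x * deriv (\<phi> (n + n0)) x) \<le> 2 * (indicator {a..b} x * \<bar>u x\<bar>)"
    proof (rule AE_I2)
      fix x
      show "norm (u x * deriv (\<phi> (n + n0)) x) \<le> 2 * (indicator {a..b} x * \<bar>u x\<bar>)"
        using Db[of "n + n0" x] supp[of "n + n0" x] mult_left_mono[OF Db[of "n + n0" x], of "\<bar>u x\<bar>"]
        unfolding deriv\<phi> by (auto simp: indicator_def abs_mult mult.commute)
    qed
  next
    show "AE x in lebesgue. (\<lambda>n. u x * deriv (\<phi> (n + n0)) x) \<longlonglongrightarrow> u x * (indicator {a..a + h} x - indicator {c..c + h} x)"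
      using AE_lebesgue_singleton[of a] AE_lebesgue_singleton[of c]
    proof eventually_elim
      case (elim x)
      have "(\<lambda>n. D n a x - D n c x) \<longlonglongrightarrow> indicator {a..a + h} x - indicator {c..c + h} x"
        unfolding D_def using elim by (intro tendsto_diff ramp_difference_tendsto[OF S(3,4) h])
      then show ?case
        unfolding deriv\<phi> by (intro tendsto_mult tendsto_const LIMSEQ_ignore_initial_segment)
    qed
  qed
  then have "\<bar>\<integral>x. u x * (indicator {a..a + h} x - indicator {c..c + h} x) \<partial>lebesgue\<bar> \<le> h * integral {a..b} (\<lambda>x. \<bar>g x\<bar>)"
    by (rule LIMSEQ_le_const2[OF tendsto_rabs]) (use bound in \<open>auto intro!: exI[of _ 0]\<close>)
  moreover have "(\<integral>x. u x * (indicator {a..a + h} x - indicator {c..c + h} x) \<partial>lebesgue) =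
      integral {a..a + h} u - integral {c..c + h} u"
  proof -
    have *: "integrable lebesgue (\<lambda>x. u x * indicator {d..d + h} x)"
      "(\<integral>x. u x * indicator {d..d + h} x \<partial>lebesgue) = integral {d..d + h} u" if "a \<le> d" "d + h \<le> b" for d
      using set_integrable_subset[OF iu, of "{d..d + h}"] that
        set_lebesgue_integral_eq_integral(2)[of "{d..d + h}" u]
      by (simp_all add: set_integrable_def set_lebesgue_integral_def mult.commute)
    show ?thesis
      unfolding right_diff_distrib using ac cb * by (subst Bochner_Integration.integral_diff) auto
  qed
  ultimately show ?thesis by simp
qed

text \<open>By Lebesgue differentiation the averages of \<open>u\<close> over
  \<open>{x..x + h}\<close> tend to \<open>u x\<close> off a null set, and the bound for interval
  integrals is divided by \<open>h\<close>. The averaging intervals extend to the right, which is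
  why the integral runs to some \<open>b > y\<close>.\<close>

lemma weak_deriv_increment_bound:
  assumes wd: "weak_deriv u g"
  obtains N where "negligible N"
    "\<And>x y b. x \<notin> N \<Longrightarrow> y \<notin> N \<Longrightarrow> x < y \<Longrightarrow> y < b \<Longrightarrow> \<bar>u y - u x\<bar> \<le> integral {x..b} (\<lambda>t. \<bar>g t\<bar>)"
proof -
  have "u integrable_on cbox a b" for a b
    using wd by (auto simp: weak_deriv_def intro: set_lebesgue_integral_eq_integral(1))
  then obtain N where N: "negligible N"
    and L: "\<And>x e. \<lbrakk>x \<notin> N; 0 < e\<rbrakk> \<Longrightarrow> \<exists>d>0. \<forall>h. 0 < h \<and> h < d \<longrightarrow>
                         norm (integral (cbox x (x + h *\<^sub>R One)) u /\<^sub>R h ^ DIM(real) - u x) < e"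
    by (rule integrable_ccontinuous_explicit) (rule that; assumption)
  have avg: "\<exists>d>0. \<forall>h. 0 < h \<and> h < d \<longrightarrow> \<bar>integral {x..x + h} u / h - u x\<bar> < e" if "x \<notin> N" "0 < e" for x e
    using L[OF that] by (simp add: divide_inverse_commute)
  show ?thesis
  proof (rule that[OF N])
    fix x y b assume x: "x \<notin> N" and y: "y \<notin> N" and xy: "x < y" and yb: "y < b"
    show "\<bar>u y - u x\<bar> \<le> integral {x..b} (\<lambda>t. \<bar>g t\<bar>)"
    proof (rule field_le_epsilon)
      fix e :: real assume e: "0 < e"
      obtain d where d: "d > 0" "\<forall>h. 0 < h \<and> h < d \<longrightarrow> \<bar>integral {x..x + h} u / h - u x\<bar> < e / 2"
        using avg[OF x, of "e / 2"] e half_gt_zero by blast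
      obtain d' where d': "d' > 0" "\<forall>h. 0 < h \<and> h < d' \<longrightarrow> \<bar>integral {y..y + h} u / h - u y\<bar> < e / 2"
        using avg[OF y, of "e / 2"] e half_gt_zero by blast
      define h where "h = min (min d d') (b - y) / 2"
      have h: "0 < h" "h < d" "h < d'" "h < b - y"
        using d(1) d'(1) yb by (auto simp: h_def min_def)
      have "\<bar>integral {x..x + h} u - integral {y..y + h} u\<bar> / h \<le> integral {x..b} (\<lambda>t. \<bar>g t\<bar>)"
        using weak_deriv_interval_averages[OF wd h(1) xy, of b] h by (simp add: field_simps)
      then have "\<bar>integral {x..x + h} u / h - integral {y..y + h} u / h\<bar> \<le> integral {x..b} (\<lambda>t. \<bar>g t\<bar>)"
        using h(1) by (simp add: abs_divide flip: diff_divide_distrib)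
      then show "\<bar>u y - u x\<bar> \<le> integral {x..b} (\<lambda>t. \<bar>g t\<bar>) + e"
        using d(2)[rule_format, of h] d'(2)[rule_format, of h] h by linarith
    qed
  qed
qed

text \<open>Beyond the threshold \<open>l\<close> one has
  \<open>(x / l) powr (p - 1) \<ge> 1\<close>. This Young-type estimate, with \<open>l\<close>
  adapted to an interval, takes the place of Hoelder's inequality.\<close>

lemma le_add_powr:
  assumes "l > 0" "p \<ge> (1::real)" "x \<ge> 0"
  shows "x \<le> l + l powr (1 - p) * x powr p"
proof (cases "x \<le> l")
  case False
  then have "l powr (p - 1) \<le> x powr (p - 1)"
    using assms by (intro powr_mono2) auto
  then have "1 \<le> l powr (1 - p) * x powr (p - 1)"
    using assms False by (simp add: powr_diff field_simps)
  then have "x \<le> (l powr (1 - p) * x powr (p - 1)) * x"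
    using assms mult_right_mono by fastforce
  also have "\<dots> = l powr (1 - p) * x powr p"
    using assms False by (simp add: powr_diff)
  finally show ?thesis using assms by simp
qed (use assms in \<open>simp add: add_increasing2\<close>)

lemma set_integrable_le_integral:
  fixes f :: "real \<Rightarrow> real"
  assumes "integrable lebesgue f" "\<And>x. 0 \<le> f x"
  shows "f integrable_on {a..b}" "integral {a..b} f \<le> (\<integral>x. f x \<partial>lebesgue)"
proof -
  have s: "set_integrable lebesgue {a..b} f"
    using integrable_mult_indicator[of "{a..b}" lebesgue f] assms(1) by (simp add: set_integrable_def)
  show "f integrable_on {a..b}"
    using s by (rule set_lebesgue_integral_eq_integral(1))
  have "integral {a..b} f = (\<integral>x. indicator {a..b} x * f x \<partial>lebesgue)"
    using set_lebesgue_integral_eq_integral(2)[OF s] by (simp add: set_lebesgue_integral_def)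
  also have "\<dots> \<le> (\<integral>x. f x \<partial>lebesgue)"
    using s assms by (intro integral_mono) (auto simp: set_integrable_def indicator_def)
  finally show "integral {a..b} f \<le> (\<integral>x. f x \<partial>lebesgue)" .
qed

text \<open>The value of \<open>u\<close> drops at most by half on an interval of length \<open>L\<close> as long as \<open>L\<close> is small
  compared to the energy.\<close>

lemma weak_deriv_mass_bound:
  assumes wd: "weak_deriv u g" and u: "in_Lp s u" and g: "in_Lp p g" and p: "p > 1" and s: "s > 0"
  shows "AE x in lebesgue. \<forall>L>0. L powr (p - 1) * (\<integral>t. \<bar>g t\<bar> powr p \<partial>lebesgue) \<le> (\<bar>u x\<bar> / 4) powr p \<longrightarrow>
    L * (\<bar>u x\<bar> / 4) powr s \<le> (\<integral>t. \<bar>u t\<bar> powr s \<partial>lebesgue)"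
proof -
  let ?A = "\<integral>t. \<bar>u t\<bar> powr s \<partial>lebesgue" and ?G = "\<integral>t. \<bar>g t\<bar> powr p \<partial>lebesgue"
  obtain N where N: "negligible N"
    and inc: "\<And>x y b. x \<notin> N \<Longrightarrow> y \<notin> N \<Longrightarrow> x < y \<Longrightarrow> y < b \<Longrightarrow> \<bar>u y - u x\<bar> \<le> integral {x..b} (\<lambda>t. \<bar>g t\<bar>)"
    using weak_deriv_increment_bound[OF wd] by blast
  have iu: "integrable lebesgue (\<lambda>t. \<bar>u t\<bar> powr s)" and ig: "integrable lebesgue (\<lambda>t. \<bar>g t\<bar> powr p)"
    using u g by (auto simp: in_Lp_def)
  show ?thesis
    using AE_lebesgue_negligible[OF N]
  proof eventually_elim
    case (elim x)
    show ?case
    proof (intro allI impI)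
      fix L assume L: "L > 0" and small: "L powr (p - 1) * ?G \<le> (\<bar>u x\<bar> / 4) powr p"
      show "L * (\<bar>u x\<bar> / 4) powr s \<le> ?A"
      proof (cases "u x = 0")
        case True
        then show ?thesis using s by (simp add: integral_nonneg_AE)
      next
        case False
        define M where "M = \<bar>u x\<bar> / 4"
        have M: "M > 0" using False by (simp add: M_def)
        have gint: "(\<lambda>t. \<bar>g t\<bar>) integrable_on {x..x + L}"
          using wd by (auto simp: weak_deriv_def intro!: set_lebesgue_integral_eq_integral(1) set_integrable_abs)
        \<comment> \<open>With threshold \<open>M / L\<close> the constant term integrates to
          exactly \<open>M\<close>, and the smallness assumption on \<open>L\<close> bounds the
          other term by \<open>M\<close> as well. The drop \<open>2 * M\<close> is half of
          \<open>\<bar>u x\<bar> = 4 * M\<close>.\<close>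
        have "integral {x..x + L} (\<lambda>t. \<bar>g t\<bar>) \<le> integral {x..x + L} (\<lambda>t. M / L + (M / L) powr (1 - p) * \<bar>g t\<bar> powr p)"
          using p M L le_add_powr[of "M / L" p]
          by (intro integral_le gint integrable_add integrable_const_ivl integrable_on_mult_right
              set_integrable_le_integral(1)[OF ig]) auto
        also have "\<dots> = M + (M / L) powr (1 - p) * integral {x..x + L} (\<lambda>t. \<bar>g t\<bar> powr p)"
          using L by (subst integral_add) (auto intro!: integrable_const_ivl integrable_on_mult_right
              set_integrable_le_integral(1)[OF ig])
        also have "\<dots> \<le> M + (M / L) powr (1 - p) * ?G"
          by (intro add_left_mono mult_left_mono set_integrable_le_integral(2)[OF ig]) auto
        also have "(M / L) powr (1 - p) * ?G = M powr (1 - p) * (L powr (p - 1) * ?G)"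
          using M L by (simp add: powr_divide powr_diff mult_ac)
        also have "M powr (1 - p) * (L powr (p - 1) * ?G) \<le> M powr (1 - p) * M powr p"
          using small unfolding M_def[symmetric] by (intro mult_left_mono) auto
        also have "\<dots> = M"
          using M by (simp flip: powr_add)
        finally have drop: "integral {x..x + L} (\<lambda>t. \<bar>g t\<bar>) \<le> 2 * M" by simp
        \<comment> \<open>The end points are excluded because the increment bound is available for
          \<open>x < y < x + L\<close> only.\<close>
        have pw: "indicator {x..x + L} y * M powr s \<le> \<bar>u y\<bar> powr s" if y: "y \<notin> N" "y \<noteq> x" "y \<noteq> x + L" for y
        proof (cases "y \<in> {x..x + L}")
          case True
          then have "\<bar>u y - u x\<bar> \<le> 2 * M"
            using inc[of x y "x + L"] y elim drop by fastforce
          then have "M \<le> \<bar>u y\<bar>"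
            using abs_triangle_ineq2_sym[of "u x" "u y"] M M_def by linarith
          then show ?thesis
            using True s M by (simp add: powr_mono2)
        qed auto
        have "AE y in lebesgue. indicator {x..x + L} y * M powr s \<le> \<bar>u y\<bar> powr s"
          using AE_lebesgue_negligible[OF N] AE_lebesgue_singleton[of x] AE_lebesgue_singleton[of "x + L"]
          by eventually_elim (rule pw)
        then have "(\<integral>y. indicator {x..x + L} y * M powr s \<partial>lebesgue) \<le> ?A"
          using lmeasurable_iff_integrable[of "{x..x + L}"]
          by (intro integral_mono_AE iu integrable_mult_left) (auto intro: fmeasurableI)
        then show ?thesis
          using L by (simp add: M_def)
      qed
    qed
  qed
qed

text \<open>The mass bound is used with the largest admissible length,
  \<open>L powr (p - 1) * G = M powr p\<close>; eliminating \<open>L\<close> leaves the product of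
  norms. The constant 4 stems from \<open>M = \<bar>u x\<bar> / 4\<close>; it only has to be
  finite.\<close>

lemma Gagliardo_Nirenberg_sup_ineq:
  assumes wd: "weak_deriv u g" and u: "in_Lp (q + 1) u" and g: "in_Lp p g" and p: "p > 1" and q: "q \<ge> 0"
  shows "esssup lebesgue (\<lambda>x. ereal \<bar>u x\<bar>) \<le>
    ereal (4 * Lp_norm (q + 1) u powr (1 - GN_theta_inf q p) * Lp_norm p g powr GN_theta_inf q p)"
proof -
  define s where "s = q + 1"
  have s: "s \<ge> 1" using q by (simp add: s_def)
  define A where "A = (\<integral>t. \<bar>u t\<bar> powr s \<partial>lebesgue)"
  define G where "G = (\<integral>t. \<bar>g t\<bar> powr p \<partial>lebesgue)"
  define d where "d = p + (p - 1) * s"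
  have d: "d > 0" using p s by (auto simp: d_def intro: add_pos_nonneg)
  have A0: "A \<ge> 0" and G0: "G \<ge> 0"
    by (auto simp: A_def G_def intro!: integral_nonneg_AE)
  have th: "GN_theta_inf q p = p / d" "1 - GN_theta_inf q p = (p - 1) * s / d"
    using d by (auto simp: GN_theta_inf_def d_def s_def field_simps)
  have rhs: "4 * Lp_norm (q + 1) u powr (1 - GN_theta_inf q p) * Lp_norm p g powr GN_theta_inf q p
     = 4 * (A powr ((p - 1) / d) * G powr (1 / d))"
    using p s unfolding th(2) unfolding th(1) Lp_norm_def A_def G_def s_def[symmetric] by (simp add: powr_powr)
  have "AE x in lebesgue. \<forall>L>0. L powr (p - 1) * G \<le> (\<bar>u x\<bar> / 4) powr p \<longrightarrow> L * (\<bar>u x\<bar> / 4) powr s \<le> A"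
    unfolding A_def G_def using weak_deriv_mass_bound[OF wd _ g p, of s] u s by (simp add: s_def)
  then have "AE x in lebesgue. \<bar>u x\<bar> \<le> 4 * (A powr ((p - 1) / d) * G powr (1 / d))"
  proof eventually_elim
    case (elim x)
    define M where "M = \<bar>u x\<bar> / 4"
    have key: "L * M powr s \<le> A" if "L > 0" "L powr (p - 1) * G \<le> M powr p" for L
      using elim that by (simp add: M_def)
    have "M \<le> A powr ((p - 1) / d) * G powr (1 / d)"
    proof (cases "M = 0")
      case False
      then have M: "M > 0" by (simp add: M_def)
      \<comment> \<open>If \<open>G = 0\<close>, every length is admissible, and the length
        \<open>A / M powr s + 1\<close> would carry more mass than \<open>A\<close>.\<close>
      have "G \<noteq> 0"
      proof
        assume "G = 0"
        then have "(A / M powr s + 1) * M powr s \<le> A"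
          using M A0 by (intro key) (auto simp: add_nonneg_pos)
        then show False using M by (simp add: distrib_right)
      qed
      with G0 have G: "G > 0" by simp
      define L where "L = (M powr p / G) powr (1 / (p - 1))"
      have L: "L > 0" using M G by (simp add: L_def)
      have "L powr (p - 1) * G = M powr p"
        using M G p by (simp add: L_def powr_powr)
      then have "L * M powr s \<le> A" using L by (intro key) auto
      \<comment> \<open>As \<open>L\<close> scales like \<open>M powr (p / (p - 1))\<close>, the
        product scales like \<open>M powr (d / (p - 1))\<close>; this root recovers
        \<open>M\<close>.\<close>
      then have "(L * M powr s) powr ((p - 1) / d) \<le> A powr ((p - 1) / d)"
        using L p d by (intro powr_mono2) auto
      moreover have "(L * M powr s) powr ((p - 1) / d) * G powr (1 / d) = M"
      proof -
        have "(L * M powr s) powr ((p - 1) / d) = (M powr p / G) powr (1 / d) * M powr (s * (p - 1) / d)"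
          using M G p by (simp add: L_def powr_mult powr_powr)
        also have "(M powr p / G) powr (1 / d) = M powr (p / d) / G powr (1 / d)"
          using M G by (simp add: powr_divide powr_powr)
        finally have "(L * M powr s) powr ((p - 1) / d) * G powr (1 / d) = M powr (p / d + s * (p - 1) / d)"
          using M G by (simp add: powr_add)
        also have "p / d + s * (p - 1) / d = 1"
          using d by (simp add: d_def field_simps flip: add_divide_distrib)
        finally show ?thesis using M by simp
      qed
      ultimately show ?thesis
        by (metis mult_right_mono powr_ge_zero)
    qed auto
    then show ?case by (simp add: M_def)
  qed
  moreover have "(\<lambda>x. ereal \<bar>u x\<bar>) \<in> borel_measurable lebesgue"
    using u by (auto simp: in_Lp_def)
  ultimately show ?thesis
    unfolding rhs by (intro esssup_I) auto
qed

section \<open>Convergence of the best constants\<close>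

lemma tendsto_const_over_at_top: "((\<lambda>m::real. c / (m + d)) \<longlongrightarrow> 0) at_top"
proof (rule tendsto_divide_0[OF tendsto_const])
  show "filterlim (\<lambda>m::real. m + d) at_infinity at_top"
    unfolding add.commute[of _ d]
    by (rule filterlim_at_top_imp_at_infinity[OF filterlim_tendsto_add_at_top[OF tendsto_const filterlim_ident]])
qed

lemma tendsto_ratio_at_top: "((\<lambda>m::real. (m - q) / (m + 1)) \<longlongrightarrow> 1) at_top"
proof (rule Lim_transform_eventually)
  show "((\<lambda>m::real. 1 - (q + 1) / (m + 1)) \<longlongrightarrow> 1) at_top"
    using tendsto_diff[OF tendsto_const tendsto_const_over_at_top, of 1 "q + 1" 1] by simp
  show "\<forall>\<^sub>F m::real in at_top. 1 - (q + 1) / (m + 1) = (m - q) / (m + 1)"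
    using eventually_gt_at_top[of 0] by eventually_elim (simp add: field_simps)
qed

text \<open>\<open>LEAST\<close> on the reals is informative only if a minimum is attained.
  Closedness and a lower bound place the infimum in the set, so a best constant satisfies its own
  inequality.\<close>

lemma Least_closed_real:
  fixes P :: "real \<Rightarrow> bool"
  assumes "closed (Collect P)" "P c" "\<And>x. P x \<Longrightarrow> b \<le> x"
  shows "P (LEAST x. P x)" and "P x \<Longrightarrow> (LEAST x. P x) \<le> x"
proof -
  have bdd: "bdd_below (Collect P)" by (rule bdd_belowI[of _ b]) (simp add: assms(3))
  have "Inf (Collect P) \<in> Collect P"
    using assms(1,2) bdd by (intro closed_contains_Inf) auto
  moreover have "Inf (Collect P) \<le> x" if "P x" for x
    using bdd that by (intro cInf_lower) auto
  ultimately have "(LEAST x. P x) = Inf (Collect P)"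
    by (intro Least_equality) auto
  then show "P (LEAST x. P x)" "P x \<Longrightarrow> (LEAST x. P x) \<le> x"
    using \<open>Inf (Collect P) \<in> Collect P\<close> \<open>P x \<Longrightarrow> Inf (Collect P) \<le> x\<close> by auto
qed

section \<open>Smooth functions of compact support as competitors\<close>

lemma in_Lp_smooth:
  assumes f: "smooth f" and z: "\<And>x. x \<notin> {a..b} \<Longrightarrow> f x = 0" and s: "s > 0"
  shows "in_Lp s f"
proof -
  have "continuous_on {a..b} (\<lambda>x. \<bar>f x\<bar> powr s)"
    using s by (intro continuous_on_powr' continuous_intros smooth_continuous_on f) auto
  then have "set_integrable lebesgue {a..b} (\<lambda>x. \<bar>f x\<bar> powr s)"
    by (rule absolutely_integrable_continuous_real)
  moreover have "indicator {a..b} x *\<^sub>R \<bar>f x\<bar> powr s = \<bar>f x\<bar> powr s" for x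
    using z[of x] by (cases "x \<in> {a..b}") auto
  ultimately show ?thesis
    using smooth_measurable[OF f] unfolding in_Lp_def set_integrable_def by (simp only: simp_thms)
qed

lemma deriv_outside_support:
  assumes "\<And>x. x \<notin> {a..b} \<Longrightarrow> f x = 0" and x: "x \<notin> {a..b}" shows "deriv f x = (0::real)"
proof -
  have "(f has_real_derivative 0) (at x)"
    by (rule has_field_derivative_transform_within_open[of "\<lambda>x. 0" 0 x "- {a..b}"])
      (use assms in \<open>auto intro: open_Compl\<close>)
  then show ?thesis by (rule DERIV_imp_deriv)
qed

lemma weak_deriv_smooth:
  assumes f: "smooth f" and z: "\<And>x. x \<notin> {a..b} \<Longrightarrow> f x = 0"
  shows "weak_deriv f (deriv f)"
  unfolding weak_deriv_def
proof (intro conjI allI impI)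
  show "f absolutely_integrable_on {c..d}" "deriv f absolutely_integrable_on {c..d}" for c d
    using f by (auto intro!: absolutely_integrable_continuous_real smooth_continuous_on smooth_deriv)
next
  fix \<phi> assume "test_function \<phi>"
  then have \<phi>: "smooth \<phi>" by (simp add: test_function_iff)
  \<comment> \<open>A margin of one unit makes \<open>f\<close> vanish at both end points;
    \<open>max a b\<close> keeps \<open>c < d\<close> even when \<open>{a..b}\<close> is
    empty.\<close>
  define c d where "c = a - 1" and "d = max a b + 1"
  have z': "deriv f x = 0" if "x \<notin> {a..b}" for x
    using deriv_outside_support[of a b f x] z that by blast
  have leb: "(\<integral>x. h x \<partial>lebesgue) = integral {c..d} h"
    if "continuous_on UNIV h" "\<And>x. x \<notin> {a..b} \<Longrightarrow> h x = 0" for h :: "real \<Rightarrow> real"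
  proof -
    have "set_integrable lebesgue {c..d} h"
      using that by (intro absolutely_integrable_continuous_real) (rule continuous_on_subset, auto)
    moreover have "h x = 0" if "x \<notin> {c..d}" for x
      using that by (intro \<open>\<And>x. x \<notin> {a..b} \<Longrightarrow> h x = 0\<close>) (auto simp: c_def d_def)
    then have "indicator {c..d} x *\<^sub>R h x = h x" for x
      by (cases "x \<in> {c..d}") auto
    ultimately show ?thesis
      using set_lebesgue_integral_eq_integral(2)[of "{c..d}" h] unfolding set_lebesgue_integral_def by (simp only:)
  qed
  have c1: "continuous_on UNIV (\<lambda>x. f x * deriv \<phi> x)" and c2: "continuous_on UNIV (\<lambda>x. deriv f x * \<phi> x)"
    using f \<phi> by (auto intro!: smooth_continuous_on smooth_mult smooth_deriv)
  have "((\<lambda>x. f x * deriv \<phi> x + deriv f x * \<phi> x) has_integral (f d * \<phi> d - f c * \<phi> c)) {c..d}"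
  proof (rule fundamental_theorem_of_calculus)
    show "((\<lambda>x. f x * \<phi> x) has_vector_derivative f x * deriv \<phi> x + deriv f x * \<phi> x) (at x within {c..d})" for x
      using DERIV_mult[OF smooth_DERIV[OF f] smooth_DERIV[OF \<phi>], of x]
      by (simp add: has_real_derivative_iff_has_vector_derivative[symmetric] algebra_simps has_field_derivative_at_within)
  qed (simp add: c_def d_def)
  moreover have "f d = 0" "f c = 0"
    by (rule z, auto simp: c_def d_def max_def)+
  ultimately have "integral {c..d} (\<lambda>x. f x * deriv \<phi> x + deriv f x * \<phi> x) = 0"
    by (simp add: integral_unique)
  moreover have "integral {c..d} (\<lambda>x. f x * deriv \<phi> x + deriv f x * \<phi> x) =
     integral {c..d} (\<lambda>x. f x * deriv \<phi> x) + integral {c..d} (\<lambda>x. deriv f x * \<phi> x)"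
    by (intro integral_add integrable_continuous_real continuous_on_subset[OF c1] continuous_on_subset[OF c2]) auto
  ultimately show "(\<integral>x. f x * deriv \<phi> x \<partial>lebesgue) = - (\<integral>x. deriv f x * \<phi> x \<partial>lebesgue)"
    using leb[OF c1] leb[OF c2] z z' by simp
qed

definition admissible :: "real \<Rightarrow> real \<Rightarrow> (real \<Rightarrow> real) \<Rightarrow> (real \<Rightarrow> real) \<Rightarrow> bool" where
  "admissible q p u g \<longleftrightarrow> in_Lp (q + 1) u \<and> weak_deriv u g \<and> in_Lp p g"

lemma Lp_norm_nonneg: "0 \<le> Lp_norm s f"
  by (simp add: Lp_norm_def)

lemma Lp_interpolation:
  assumes u: "in_Lp (q + 1) u" and B: "AE x in lebesgue. \<bar>u x\<bar> \<le> B" and q: "q \<ge> 0" and m: "m > q" and B0: "0 \<le> B"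
  shows "in_Lp (m + 1) u"
    and "Lp_norm (m + 1) u \<le> B powr ((m - q) / (m + 1)) * Lp_norm (q + 1) u powr ((q + 1) / (m + 1))"
proof -
  have um: "u \<in> borel_measurable lebesgue" and ui: "integrable lebesgue (\<lambda>x. \<bar>u x\<bar> powr (q + 1))"
    using u by (auto simp: in_Lp_def)
  let ?A = "\<integral>x. \<bar>u x\<bar> powr (q + 1) \<partial>lebesgue"
  have bd: "AE x in lebesgue. \<bar>u x\<bar> powr (m + 1) \<le> B powr (m - q) * \<bar>u x\<bar> powr (q + 1)"
    using B
  proof eventually_elim
    case (elim x)
    have "\<bar>u x\<bar> powr (m + 1) = \<bar>u x\<bar> powr (m - q) * \<bar>u x\<bar> powr (q + 1)"
      by (simp flip: powr_add)
    also have "\<dots> \<le> B powr (m - q) * \<bar>u x\<bar> powr (q + 1)"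
      using elim m by (intro mult_right_mono powr_mono2) auto
    finally show ?case .
  qed
  have bi: "integrable lebesgue (\<lambda>x. B powr (m - q) * \<bar>u x\<bar> powr (q + 1))"
    using ui by simp
  have mi: "integrable lebesgue (\<lambda>x. \<bar>u x\<bar> powr (m + 1))"
  proof (rule Bochner_Integration.integrable_bound[OF bi])
    show "(\<lambda>x. \<bar>u x\<bar> powr (m + 1)) \<in> borel_measurable lebesgue"
      using um by measurable
    show "AE x in lebesgue. norm (\<bar>u x\<bar> powr (m + 1)) \<le> norm (B powr (m - q) * \<bar>u x\<bar> powr (q + 1))"
      using bd by eventually_elim simp
  qed
  then show "in_Lp (m + 1) u"
    using um by (simp add: in_Lp_def)
  have A0: "0 \<le> ?A" by (intro integral_nonneg_AE) auto
  have "(\<integral>x. \<bar>u x\<bar> powr (m + 1) \<partial>lebesgue) \<le> (\<integral>x. B powr (m - q) * \<bar>u x\<bar> powr (q + 1) \<partial>lebesgue)"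
    by (intro integral_mono_AE mi bi bd)
  then have "(\<integral>x. \<bar>u x\<bar> powr (m + 1) \<partial>lebesgue) \<le> B powr (m - q) * ?A"
    by simp
  then have "Lp_norm (m + 1) u \<le> (B powr (m - q) * ?A) powr (1 / (m + 1))"
    unfolding Lp_norm_def using m q by (intro powr_mono2) (auto intro!: integral_nonneg_AE)
  also have "\<dots> = B powr ((m - q) / (m + 1)) * ?A powr (1 / (m + 1))"
    using A0 by (simp add: powr_mult powr_powr)
  also have "?A powr (1 / (m + 1)) = Lp_norm (q + 1) u powr ((q + 1) / (m + 1))"
    using q by (simp add: Lp_norm_def powr_powr)
  finally show "Lp_norm (m + 1) u \<le> B powr ((m - q) / (m + 1)) * Lp_norm (q + 1) u powr ((q + 1) / (m + 1))" .
qed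

text \<open>Chebyshev's inequality; the factor \<open>\<mu> powr (1 / (m + 1))\<close> tends to 1.\<close>

lemma Lp_norm_ge_level:
  assumes u: "in_Lp (q + 1) u" and K: "0 < K" "ereal K < esssup lebesgue (\<lambda>x. ereal \<bar>u x\<bar>)" and q: "q \<ge> 0"
  obtains \<mu> where "\<mu> > 0" "\<And>m. m > q \<Longrightarrow> in_Lp (m + 1) u \<Longrightarrow> K * \<mu> powr (1 / (m + 1)) \<le> Lp_norm (m + 1) u"
proof -
  have um: "u \<in> borel_measurable lebesgue" and ui: "integrable lebesgue (\<lambda>x. \<bar>u x\<bar> powr (q + 1))"
    using u by (auto simp: in_Lp_def)
  define T where "T = {x \<in> space lebesgue. ereal \<bar>u x\<bar> > ereal K}"
  have em: "(\<lambda>x. ereal \<bar>u x\<bar>) \<in> borel_measurable lebesgue" using um by measurable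
  have T: "T \<in> sets lebesgue" unfolding T_def using um by measurable
  have pos: "emeasure lebesgue T > 0"
    unfolding T_def by (rule esssup_pos_measure[OF em K(2)])
  have TK: "K powr s * indicator T x \<le> \<bar>u x\<bar> powr s" if "s > 0" for s x
    using that K(1) by (auto simp: T_def indicator_def intro!: powr_mono2)
  \<comment> \<open>Integrability of \<open>\<bar>u\<bar> powr (q + 1)\<close> makes the level set
    \<open>T\<close> finite in measure; an infinite measure would be turned into 0 by
    \<open>measure\<close>.\<close>
  have "integrable lebesgue (\<lambda>x. K powr (q + 1) * indicator T x :: real)"
  proof (rule Bochner_Integration.integrable_bound[OF ui])
    show "(\<lambda>x. K powr (q + 1) * indicator T x) \<in> borel_measurable lebesgue" using T by measurable
    show "AE x in lebesgue. norm (K powr (q + 1) * indicator T x) \<le> norm (\<bar>u x\<bar> powr (q + 1))"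
      using TK[of "q + 1"] q by simp
  qed
  then have Ti: "integrable lebesgue (indicator T :: real \<Rightarrow> real)"
    using K(1) by simp
  then have Tf: "T \<in> lmeasurable" by (simp add: lmeasurable_iff_integrable)
  have "measure lebesgue T > 0"
    using pos emeasure_eq_measure2[OF Tf] by (simp add: zero_less_measure_iff)
  moreover have "K * measure lebesgue T powr (1 / (m + 1)) \<le> Lp_norm (m + 1) u" if m: "m > q" and i: "in_Lp (m + 1) u" for m
  proof -
    have "K powr (m + 1) * measure lebesgue T = (\<integral>x. K powr (m + 1) * indicator T x \<partial>lebesgue)"
      using Tf by simp
    also have "\<dots> \<le> (\<integral>x. \<bar>u x\<bar> powr (m + 1) \<partial>lebesgue)"
      using i m q TK[of "m + 1"] Ti by (intro integral_mono) (auto simp: in_Lp_def)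
    finally have "(K powr (m + 1) * measure lebesgue T) powr (1 / (m + 1)) \<le> Lp_norm (m + 1) u"
      unfolding Lp_norm_def using m q by (intro powr_mono2) auto
    then show ?thesis
      using K(1) m q by (simp add: powr_mult powr_powr)
  qed
  ultimately show ?thesis by (rule that)
qed

section \<open>Best constants: attainment, upper bound and limit\<close>

context
  fixes q p :: real
  assumes p: "p > 1" and q: "q \<ge> 0"
begin

abbreviation "\<theta> \<equiv> GN_theta_inf q p"

definition GN_bound :: "(real \<Rightarrow> real) \<Rightarrow> (real \<Rightarrow> real) \<Rightarrow> real" where
  "GN_bound u g = Lp_norm (q + 1) u powr (1 - \<theta>) * Lp_norm p g powr \<theta>"

lemma GN_bound_nonneg: "0 \<le> GN_bound u g"
  by (simp add: GN_bound_def)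

text \<open>The exponent for finite \<open>m\<close> is the one for the supremum times the
  interpolation weight \<open>(m - q) / (m + 1)\<close>; this makes the powers of the norms match
  exactly after interpolation.\<close>

lemma GN_theta_eq: "m > q \<Longrightarrow> GN_theta q m p = \<theta> * ((m - q) / (m + 1))"
  by (simp add: GN_theta_def GN_theta_inf_def)

lemma esssup_real:
  assumes "admissible q p u g"
  obtains e where "e \<ge> 0" "esssup lebesgue (\<lambda>x. ereal \<bar>u x\<bar>) = ereal e"
proof -
  let ?E = "esssup lebesgue (\<lambda>x. ereal \<bar>u x\<bar>)"
  have "?E \<le> ereal (4 * Lp_norm (q + 1) u powr (1 - \<theta>) * Lp_norm p g powr \<theta>)"
    using assms p q by (intro Gagliardo_Nirenberg_sup_ineq) (auto simp: admissible_def)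
  moreover have "esssup lebesgue (\<lambda>x::real. 0::ereal) \<le> ?E"
    by (rule esssup_mono) auto
  then have "0 \<le> ?E"
    by (subst (asm) esssup_const) auto
  ultimately show ?thesis
    using that by (cases ?E) auto
qed

definition sup_const :: "real \<Rightarrow> bool" where
  "sup_const C \<longleftrightarrow> (\<forall>u g. admissible q p u g \<longrightarrow> esssup lebesgue (\<lambda>x. ereal \<bar>u x\<bar>) \<le> ereal (C * GN_bound u g))"

definition Lm_const :: "real \<Rightarrow> real \<Rightarrow> bool" where
  "Lm_const m C \<longleftrightarrow> (\<forall>u g. admissible q p u g \<longrightarrow> in_Lp (m + 1) u \<and> Lp_norm (m + 1) u \<le>
     C * (Lp_norm (q + 1) u powr (1 - GN_theta q m p) * Lp_norm p g powr GN_theta q m p))"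

lemma GN_const_inf_eq: "GN_const_inf q p = (LEAST C. sup_const C)"
  by (simp add: GN_const_inf_def sup_const_def admissible_def GN_bound_def mult.assoc)

lemma GN_const_eq: "GN_const q m p = (LEAST C. Lm_const m C)"
  by (simp add: GN_const_def Lm_const_def admissible_def mult.assoc)

lemma sup_const_4: "sup_const 4"
  using Gagliardo_Nirenberg_sup_ineq p q
  by (auto simp: sup_const_def admissible_def GN_bound_def mult.assoc)

lemma admissible_bump: "admissible q p bump (deriv bump)"
proof -
  have z: "bump x = 0" if "x \<notin> {0..1}" for x
    using that by (intro bump_eq_0) auto
  then show ?thesis
    unfolding admissible_def using p q
    by (intro conjI in_Lp_smooth[of _ 0 1] weak_deriv_smooth[of _ 0 1] smooth_bump smooth_deriv
        deriv_outside_support[of 0 1 bump]) auto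
qed

lemma esssup_bump_pos: "esssup lebesgue (\<lambda>x. ereal \<bar>bump x\<bar>) > 0"
proof (rule ccontr)
  assume "\<not> ?thesis"
  then have le: "esssup lebesgue (\<lambda>x. ereal \<bar>bump x\<bar>) \<le> 0" by simp
  have "AE x in lebesgue. ereal \<bar>bump x\<bar> \<le> 0"
    using esssup_AE[where M = lebesgue and f = "\<lambda>x. ereal \<bar>bump x\<bar>"]
  proof eventually_elim
    case (elim x)
    then show ?case using le by (rule order_trans)
  qed
  then have "AE x in lebesgue. x \<notin> {0<..<1::real}"
  proof eventually_elim
    case (elim x)
    then show ?case using bump_pos[of x] by auto
  qed
  then have "{0<..<1::real} \<in> null_sets lebesgue"
    using AE_iff_null_sets[of "{0<..<1::real}" lebesgue] by simp
  then show False
    using open_not_negligible[of "{0<..<1::real}"] by (auto simp: negligible_iff_null_sets)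
qed

text \<open>\<open>bump\<close> has positive essential supremum, so the inequality with constant 4
  forces its right-hand side to be positive; no norm has to be computed.\<close>

lemma GN_bound_bump_pos: "0 < GN_bound bump (deriv bump)"
proof -
  have "ereal 0 < ereal (4 * GN_bound bump (deriv bump))"
    using esssup_bump_pos sup_const_4 admissible_bump unfolding sup_const_def
    by (metis order_less_le_trans zero_ereal_def)
  then show ?thesis by simp
qed

text \<open>Since \<open>0 powr x = 0\<close> for every exponent \<open>x\<close>, one vanishing
  norm makes the whole product vanish.\<close>

lemma Lp_norm_pos_if_GN_bound_pos:
  assumes "0 < GN_bound u g" shows "0 < Lp_norm (q + 1) u" "0 < Lp_norm p g"
  using assms Lp_norm_nonneg[of "q + 1" u] Lp_norm_nonneg[of p g]
  by (auto simp: GN_bound_def order.order_iff_strict)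

lemma sup_const_pos:
  assumes "sup_const C" shows "0 < C"
proof -
  have "ereal 0 < ereal (C * GN_bound bump (deriv bump))"
    using assms esssup_bump_pos admissible_bump unfolding sup_const_def
    by (metis order_less_le_trans zero_ereal_def)
  then show ?thesis
    using GN_bound_bump_pos by (simp add: zero_less_mult_iff)
qed

lemma closed_sup_const: "closed (Collect sup_const)"
  unfolding sup_const_def
  by (intro closed_Collect_all closed_Collect_imp open_Collect_const closed_Collect_le
      continuous_on_const continuous_on_ereal continuous_intros)

lemma closed_Lm_const: "closed (Collect (Lm_const m))"
  unfolding Lm_const_def
  by (intro closed_Collect_all closed_Collect_imp closed_Collect_conj open_Collect_const closed_Collect_const
      closed_Collect_le continuous_intros)

lemma sup_const_GN: "sup_const (GN_const_inf q p)"
  and GN_const_inf_le: "sup_const C \<Longrightarrow> GN_const_inf q p \<le> C"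
  unfolding GN_const_inf_eq
  using Least_closed_real[of sup_const 4 0, OF closed_sup_const sup_const_4] sup_const_pos
  by (auto intro: less_imp_le)

lemma Lm_const_interpolation:
  assumes m: "m > q" shows "Lm_const m (GN_const_inf q p powr ((m - q) / (m + 1)))"
  unfolding Lm_const_def
proof (intro allI impI)
  fix u g assume adm: "admissible q p u g"
  let ?C = "GN_const_inf q p" and ?\<mu> = "(m - q) / (m + 1)"
  have C: "0 < ?C" using sup_const_GN by (rule sup_const_pos)
  have u: "in_Lp (q + 1) u" using adm by (simp add: admissible_def)
  have le: "esssup lebesgue (\<lambda>x. ereal \<bar>u x\<bar>) \<le> ereal (?C * GN_bound u g)"
    using sup_const_GN adm by (simp add: sup_const_def)
  have "AE x in lebesgue. \<bar>u x\<bar> \<le> ?C * GN_bound u g"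
    using esssup_AE[where M = lebesgue and f = "\<lambda>x. ereal \<bar>u x\<bar>"]
  proof eventually_elim
    case (elim x)
    then show ?case using le by (metis ereal_less_eq(3) order_trans)
  qed
  note int = Lp_interpolation[OF u this q m mult_nonneg_nonneg[OF less_imp_le[OF C] GN_bound_nonneg]]
  \<comment> \<open>The exponent of the \<open>L^(q+1)\<close> norm: the share
    \<open>(1 - \<theta>) * ?\<mu>\<close> comes from the supremum bound, the rest from the
    interpolation.\<close>
  have e: "1 - GN_theta q m p = (1 - \<theta>) * ?\<mu> + (q + 1) / (m + 1)"
  proof -
    have 1: "(q + 1) / (m + 1) = 1 - ?\<mu>" using m q by (simp add: field_simps)
    have "1 - \<theta> * r = (1 - \<theta>) * r + (1 - r)" for r :: real by (simp add: algebra_simps)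
    then show ?thesis unfolding GN_theta_eq[OF m] 1 .
  qed
  have "(?C * GN_bound u g) powr ?\<mu> * Lp_norm (q + 1) u powr ((q + 1) / (m + 1)) =
    ?C powr ?\<mu> * (Lp_norm (q + 1) u powr (1 - GN_theta q m p) * Lp_norm p g powr GN_theta q m p)"
    unfolding e powr_add using C GN_theta_eq[OF m]
    by (simp add: GN_bound_def powr_mult powr_powr mult_ac)
  with int show "in_Lp (m + 1) u \<and> Lp_norm (m + 1) u \<le>
     ?C powr ?\<mu> * (Lp_norm (q + 1) u powr (1 - GN_theta q m p) * Lp_norm p g powr GN_theta q m p)"
    by simp
qed

lemma Lm_const_nonneg:
  assumes "Lm_const m C" shows "0 \<le> C"
proof -
  let ?D = "Lp_norm (q + 1) bump powr (1 - GN_theta q m p) * Lp_norm p (deriv bump) powr GN_theta q m p"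
  have "0 \<le> Lp_norm (m + 1) bump" by (rule Lp_norm_nonneg)
  also have "\<dots> \<le> C * ?D"
    using assms admissible_bump by (simp add: Lm_const_def)
  finally have "0 \<le> C * ?D" .
  moreover have "0 < ?D"
    using Lp_norm_pos_if_GN_bound_pos[OF GN_bound_bump_pos] by simp
  ultimately show ?thesis by (simp only: zero_le_mult_iff) linarith
qed

lemma
  assumes m: "m > q"
  shows Lm_const_GN: "Lm_const m (GN_const q m p)"
    and GN_const_le: "GN_const q m p \<le> GN_const_inf q p powr ((m - q) / (m + 1))"
proof -
  note I = Lm_const_interpolation[OF m]
  note L = Least_closed_real[of "Lm_const m", OF closed_Lm_const I Lm_const_nonneg]
  show "Lm_const m (GN_const q m p)"
    unfolding GN_const_eq by (rule L(1))
  show "GN_const q m p \<le> GN_const_inf q p powr ((m - q) / (m + 1))"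
    unfolding GN_const_eq by (rule L(2)[OF _ I])
qed

lemma GN_const_tendsto: "((\<lambda>m. GN_const q m p) \<longlongrightarrow> GN_const_inf q p) at_top"
proof (rule order_tendstoI)
  let ?C = "GN_const_inf q p"
  have C: "0 < ?C" using sup_const_GN by (rule sup_const_pos)
  note ratio = tendsto_ratio_at_top[of q]
  {
    fix a assume a: "?C < a"
    have "((\<lambda>m. ?C powr ((m - q) / (m + 1))) \<longlongrightarrow> ?C powr 1) at_top"
      using C by (intro tendsto_powr tendsto_const ratio) auto
    then have "\<forall>\<^sub>F m in at_top. ?C powr ((m - q) / (m + 1)) < a"
      using a C by (intro order_tendstoD(2)) auto
    then show "\<forall>\<^sub>F m in at_top. GN_const q m p < a"
      using eventually_gt_at_top[of q]
      by eventually_elim (use GN_const_le in \<open>blast intro: le_less_trans\<close>)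
  next
    fix a assume "a < ?C"
    \<comment> \<open>Truncation at 0 keeps the level \<open>K\<close> chosen below positive, as the
      level estimate requires.\<close>
    define b where "b = max a 0"
    have b: "b < ?C" "0 \<le> b" using \<open>a < ?C\<close> C by (auto simp: b_def)
    then have "\<not> sup_const b" using GN_const_inf_le by force
    then obtain u g where adm: "admissible q p u g"
      and gt: "ereal (b * GN_bound u g) < esssup lebesgue (\<lambda>x. ereal \<bar>u x\<bar>)"
      by (auto simp: sup_const_def not_le)
    obtain e where e: "esssup lebesgue (\<lambda>x. ereal \<bar>u x\<bar>) = ereal e"
      using esssup_real[OF adm] by blast
    have be: "b * GN_bound u g < e" using gt e by simp
    moreover have "e \<le> ?C * GN_bound u g"
      using sup_const_GN[unfolded sup_const_def, rule_format, OF adm] e by simp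
    ultimately have "b * GN_bound u g < ?C * GN_bound u g" by simp
    \<comment> \<open>The strict gap rules out vanishing norms, so powers of the norms depend
      continuously on the exponent.\<close>
    then have D: "0 < GN_bound u g"
      using GN_bound_nonneg[of u g] by (auto simp: order.order_iff_strict)
    note N = Lp_norm_pos_if_GN_bound_pos[OF D]
    obtain K where K: "b * GN_bound u g < K" "K < e" using dense[OF be] by blast
    have K0: "0 < K" using K(1) b(2) D by (smt (verit) mult_nonneg_nonneg)
    obtain \<mu> where \<mu>: "\<mu> > 0" "\<And>m. m > q \<Longrightarrow> in_Lp (m + 1) u \<Longrightarrow> K * \<mu> powr (1 / (m + 1)) \<le> Lp_norm (m + 1) u"
      using Lp_norm_ge_level[OF _ K0 _ q, of u] adm K(2) e by (auto simp: admissible_def)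
    \<comment> \<open>The right-hand side of the inequality for \<open>m\<close> without its
      constant. It tends to \<open>GN_bound u g\<close> while
      \<open>K * \<mu> powr (1 / (m + 1))\<close> tends to \<open>K\<close>, so
      \<open>b * GN_bound u g < K\<close> survives for large \<open>m\<close>.\<close>
    define D where "D = (\<lambda>m. Lp_norm (q + 1) u powr (1 - \<theta> * ((m - q) / (m + 1))) * Lp_norm p g powr (\<theta> * ((m - q) / (m + 1))))"
    have Dpos: "0 < D m" for m using N by (simp add: D_def)
    have "((\<lambda>m. D m) \<longlongrightarrow> Lp_norm (q + 1) u powr (1 - \<theta> * 1) * Lp_norm p g powr (\<theta> * 1)) at_top"
      unfolding D_def using N by (intro tendsto_intros ratio) auto
    then have Dlim: "(D \<longlongrightarrow> GN_bound u g) at_top"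
      by (simp add: GN_bound_def)
    have "((\<lambda>m. K * \<mu> powr (1 / (m + 1))) \<longlongrightarrow> K * \<mu> powr 0) at_top"
      using \<mu>(1) by (intro tendsto_mult tendsto_powr tendsto_const tendsto_const_over_at_top) auto
    from tendsto_diff[OF this tendsto_mult_left[OF Dlim, of b]]
    have "((\<lambda>m. K * \<mu> powr (1 / (m + 1)) - b * D m) \<longlongrightarrow> K * \<mu> powr 0 - b * GN_bound u g) at_top" .
    then have "\<forall>\<^sub>F m in at_top. 0 < K * \<mu> powr (1 / (m + 1)) - b * D m"
      by (rule order_tendstoD(1)) (use \<mu>(1) K(1) in simp)
    then show "\<forall>\<^sub>F m in at_top. a < GN_const q m p"
      using eventually_gt_at_top[of q]
    proof eventually_elim
      case (elim m)
      have "in_Lp (m + 1) u" "Lp_norm (m + 1) u \<le> GN_const q m p * D m"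
        using Lm_const_GN[OF elim(2)] adm GN_theta_eq[OF elim(2)] by (auto simp: Lm_const_def D_def)
      then have "b * D m < GN_const q m p * D m"
        using \<mu>(2)[OF elim(2)] elim(1) by linarith
      then have "b < GN_const q m p" using Dpos[of m] by simp
      then show ?case by (simp add: b_def)
    qed
  }
qed

end

section \<open>The first-order equation\<close>

text \<open>A mean value estimate that asks for differentiability in the open interval only, because
  the equation is not imposed at 0 or at a free boundary point.\<close>

lemma le_if_derivative_le:
  fixes v :: "real \<Rightarrow> real"
  assumes "s \<le> t" "continuous_on {s..t} v"
    and "\<And>r. s < r \<Longrightarrow> r < t \<Longrightarrow> \<exists>D\<le>k. (v has_real_derivative D) (at r)"
  shows "v t \<le> v s + k * (t - s)"
proof (cases "s = t")
  case False
  obtain D where D: "D r \<le> k" "(v has_real_derivative D r) (at r)" if "s < r" "r < t" for r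
    using assms(3) by metis
  have "s < t" using False assms(1) by simp
  then obtain \<xi> where \<xi>: "s < \<xi>" "\<xi> < t" "v t - v s = D \<xi> * (t - s)"
    by (rule mvt[OF _ assms(2), where f' = "\<lambda>r h. D r * h"])
      (use D(2) in \<open>auto simp: has_field_derivative_def\<close>)
  have "D \<xi> * (t - s) \<le> k * (t - s)"
    using D(1)[OF \<xi>(1,2)] assms(1) by (intro mult_right_mono) auto
  then show ?thesis using \<xi>(3) by linarith
qed auto

lemma DERIV_abs_powr:
  fixes x b :: real
  assumes b: "b > 1"
  shows "((\<lambda>x. \<bar>x\<bar> powr b) has_real_derivative b * \<bar>x\<bar> powr (b - 1) * sgn x) (at x)"
proof -
  consider "x < 0" | "x = 0" | "x > 0" by linarith
  then show ?thesis
  proof cases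
    case 1
    have "((\<lambda>x. (- x) powr b) has_real_derivative b * \<bar>x\<bar> powr (b - 1) * sgn x) (at x)"
      using 1 by (auto intro!: derivative_eq_intros)
    then show ?thesis
      by (rule has_field_derivative_transform_within_open[of _ _ _ "{..<0}"]) (use 1 in auto)
  next
    case 2
    have "((\<lambda>h. \<bar>h\<bar> powr b / h) \<longlongrightarrow> 0) (at 0)"
    proof (rule Lim_null_comparison)
      have "((\<lambda>h::real. \<bar>h\<bar> powr (b - 1)) \<longlongrightarrow> 0 powr (b - 1)) (at 0)"
        using b by (intro tendsto_powr' tendsto_const) (auto intro!: tendsto_eq_intros)
      then show "((\<lambda>h::real. \<bar>h\<bar> powr (b - 1)) \<longlongrightarrow> 0) (at 0)" by simp
      show "\<forall>\<^sub>F h in at 0. norm (\<bar>h\<bar> powr b / h) \<le> \<bar>h\<bar> powr (b - 1)"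
        by (auto simp: eventually_at_filter powr_diff)
    qed
    then show ?thesis
      using 2 by (simp add: has_field_derivative_iff)
  next
    case 3
    have "((\<lambda>x. x powr b) has_real_derivative b * \<bar>x\<bar> powr (b - 1) * sgn x) (at x)"
      using 3 by (auto intro!: derivative_eq_intros)
    then show ?thesis
      by (rule has_field_derivative_transform_within_open[of _ _ _ "{0<..}"]) (use 3 in auto)
  qed
qed

text \<open>\<open>p / (p - 1)\<close> is conjugate to \<open>p\<close>: the power
  \<open>|w|^(p/(p-1))\<close> is \<open>|d|^p\<close>, and its derivative in \<open>w\<close> is a
  multiple of \<open>d\<close>. The energy can thus be differentiated through the flux, without a
  second derivative of \<open>u\<close>, which the equation does not provide.\<close>

lemma abs_flux_powr:
  fixes d p :: real
  assumes p: "p > 1"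
  defines "w \<equiv> \<bar>d\<bar> powr (p - 2) * d"
  shows "\<bar>w\<bar> powr (p / (p - 1)) = \<bar>d\<bar> powr p" "\<bar>w\<bar> powr (p / (p - 1) - 1) * sgn w = d"
proof -
  have aw: "\<bar>w\<bar> = \<bar>d\<bar> powr (p - 1)"
    by (cases "d = 0") (auto simp: w_def abs_mult powr_mult_base powr_diff power2_eq_square)
  show "\<bar>w\<bar> powr (p / (p - 1)) = \<bar>d\<bar> powr p"
    using p by (simp add: aw powr_powr)
  have e: "p / (p - 1) - 1 = 1 / (p - 1)" using p by (simp add: field_simps)
  show "\<bar>w\<bar> powr (p / (p - 1) - 1) * sgn w = d"
    unfolding e aw using p by (cases "d = 0") (simp_all add: powr_powr w_def sgn_mult abs_mult_sgn)
qed

text \<open>All four problems have this shape: \<open>f\<close> is the right-hand side,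
  \<open>F\<close> its primitive and \<open>I\<close> the open interval on which the equation holds.
  \<open>F\<close> is differentiable at positive values and continuous at 0, where the solution
  ends. The slope at 0 stays outside: it is prescribed for finite \<open>m\<close>, whereas the
  limit problems prescribe \<open>u 0 = 1\<close>.\<close>

locale profile =
  fixes p :: real and u :: "real \<Rightarrow> real" and f F :: "real \<Rightarrow> real" and I :: "real set"
  assumes p: "p > 1"
    and cont: "continuous_on {0..} u"
    and anti: "antimono_on {0..} u"
    and diff: "\<And>r. r \<in> I \<Longrightarrow> u differentiable (at r)"
    and flux_diff: "\<And>r. r \<in> I \<Longrightarrow> plap_flux p u differentiable (at r)"
    and eq: "\<And>r. r \<in> I \<Longrightarrow> plap p u r = f (u r)"
    and pos: "\<And>r. r \<in> I \<Longrightarrow> 0 < u r"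
    and F: "\<And>s. s > 0 \<Longrightarrow> (F has_real_derivative f s) (at s)" "continuous_on {0..} F" "F 0 = 0"
    and vanishing: "I = {0<..} \<and> (u \<longlongrightarrow> 0) at_top \<or>
      (\<exists>R>0. I = {0<..<R} \<and> u R = 0 \<and> (u has_real_derivative 0) (at R))"
begin

lemma I_pos: "r \<in> I \<Longrightarrow> 0 < r"
  using vanishing by auto

lemma I_down: "r \<in> I \<Longrightarrow> 0 < s \<Longrightarrow> s \<le> r \<Longrightarrow> s \<in> I"
  using vanishing by auto

lemma I_convex: "convex I"
  using vanishing by auto

lemma DERIV_u: "r \<in> I \<Longrightarrow> (u has_real_derivative deriv u r) (at r)"
  using diff DERIV_deriv_iff_real_differentiable by blast

lemma antimonoD: "0 \<le> r \<Longrightarrow> r \<le> s \<Longrightarrow> u s \<le> u r"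
  using anti by (auto simp: monotone_on_def)

lemma deriv_nonpos:
  assumes "r \<in> I" shows "deriv u r \<le> 0"
proof -
  have "mono_on {0..} (\<lambda>x. - u x)"
    using anti by (auto simp: monotone_on_def)
  from mono_on_imp_deriv_nonneg[OF this DERIV_minus[OF DERIV_u[OF assms]]] show ?thesis
    using I_pos[OF assms] by simp
qed

lemma energy:
  obtains e where "\<And>r. r \<in> I \<Longrightarrow> \<bar>deriv u r\<bar> powr p = p / (p - 1) * (F (u r) + e)"
proof -
  let ?w = "plap_flux p u"
  have b: "p / (p - 1) > 1" using p by simp
  define E where "E = (\<lambda>r. (p - 1) / p * \<bar>?w r\<bar> powr (p / (p - 1)) - F (u r))"
  have "(E has_real_derivative 0) (at r within I)" if r: "r \<in> I" for r
  proof -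
    have "(?w has_real_derivative f (u r)) (at r)"
      using flux_diff[OF r] eq[OF r] by (simp add: DERIV_deriv_iff_real_differentiable[symmetric] plap_def)
    then have "((\<lambda>r. \<bar>?w r\<bar> powr (p / (p - 1))) has_real_derivative
        p / (p - 1) * \<bar>?w r\<bar> powr (p / (p - 1) - 1) * sgn (?w r) * f (u r)) (at r)"
      by (rule DERIV_chain2[OF DERIV_abs_powr[OF b]])
    moreover have "((\<lambda>r. F (u r)) has_real_derivative f (u r) * deriv u r) (at r)"
      using DERIV_chain2[OF F(1)[OF pos[OF r]] DERIV_u[OF r]] .
    ultimately have "(E has_real_derivative (p - 1) / p * (p / (p - 1) * \<bar>?w r\<bar> powr (p / (p - 1) - 1) * sgn (?w r) * f (u r)) - f (u r) * deriv u r) (at r)"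
      unfolding E_def by (intro DERIV_diff DERIV_cmult)
    moreover have "(p - 1) / p * (p / (p - 1) * \<bar>?w r\<bar> powr (p / (p - 1) - 1) * sgn (?w r) * f (u r)) =
        (\<bar>?w r\<bar> powr (p / (p - 1) - 1) * sgn (?w r)) * f (u r)"
      using p by simp
    moreover have "\<bar>?w r\<bar> powr (p / (p - 1) - 1) * sgn (?w r) = deriv u r"
      unfolding plap_flux_def by (rule abs_flux_powr(2)[OF p])
    ultimately show ?thesis
      by (auto intro: has_field_derivative_at_within)
  qed
  then obtain e where e: "\<forall>r\<in>I. E r = e"
    using has_field_derivative_zero_constant[OF I_convex] by blast
  show ?thesis
  proof (rule that[of e])
    fix r assume "r \<in> I"
    then have "(p - 1) / p * \<bar>deriv u r\<bar> powr p = F (u r) + e"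
      using e abs_flux_powr(1)[OF p, of "deriv u r"] by (auto simp: E_def plap_flux_def)
    then show "\<bar>deriv u r\<bar> powr p = p / (p - 1) * (F (u r) + e)"
      using p by (auto simp: field_simps)
  qed
qed

lemma steep:
  assumes "r \<in> I" "k > 0" "k \<le> \<bar>deriv u r\<bar> powr p" shows "deriv u r \<le> - (k powr (1 / p))"
proof -
  have "k powr (1 / p) \<le> (\<bar>deriv u r\<bar> powr p) powr (1 / p)"
    using assms p by (intro powr_mono2) auto
  then show ?thesis
    using deriv_nonpos[OF assms(1)] p by (simp add: powr_powr)
qed

lemma u_le_line:
  assumes "0 \<le> s" "s \<le> t" "\<And>r. s < r \<Longrightarrow> r < t \<Longrightarrow> r \<in> I \<and> deriv u r \<le> - k"
  shows "u t \<le> u s - k * (t - s)"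
  using le_if_derivative_le[of s t u "- k"] assms continuous_on_subset[OF cont, of "{s..t}"] DERIV_u
  by (simp, blast)

text \<open>Positive energy would give \<open>u\<close> a negative slope where it vanishes.\<close>

lemma zero_energy:
  assumes "r \<in> I" shows "\<bar>deriv u r\<bar> powr p = p / (p - 1) * F (u r)"
proof -
  obtain e where e: "\<And>r. r \<in> I \<Longrightarrow> \<bar>deriv u r\<bar> powr p = p / (p - 1) * (F (u r) + e)"
    using energy by blast
  \<comment> \<open>Half of the limit of \<open>\<bar>deriv u r\<bar> powr p\<close>; if it is
    positive, the slope is eventually bounded away from 0.\<close>
  define k where "k = p / (p - 1) * e / 2"
  have lim: "((\<lambda>r. \<bar>deriv u r\<bar> powr p) \<longlongrightarrow> 2 * k) L"
    if u0: "(u \<longlongrightarrow> 0) L" and ev: "\<forall>\<^sub>F r in L. r \<in> I" for L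
  proof -
    have "((\<lambda>r. F (u r)) \<longlongrightarrow> F 0) L"
      by (rule continuous_on_tendsto_compose[OF F(2) u0])
        (use ev pos in \<open>auto elim!: eventually_mono intro: less_imp_le\<close>)
    then have "((\<lambda>r. p / (p - 1) * (F (u r) + e)) \<longlongrightarrow> p / (p - 1) * (F 0 + e)) L"
      by (intro tendsto_intros)
    moreover have "p / (p - 1) * (F 0 + e) = 2 * k"
      unfolding k_def F(3) using p by (simp add: field_simps)
    ultimately have "((\<lambda>r. p / (p - 1) * (F (u r) + e)) \<longlongrightarrow> 2 * k) L"
      by (simp only:)
    then show ?thesis
      by (rule Lim_transform_eventually) (use ev e in \<open>auto elim!: eventually_mono\<close>)
  qed
  have "e = 0"
  proof -
    consider "I = {0<..}" "(u \<longlongrightarrow> 0) at_top" |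
      R where "R > 0" "I = {0<..<R}" "u R = 0" "(u has_real_derivative 0) (at R)"
      using vanishing by blast
    then have "k = 0"
    proof cases
      case 1
      note l = lim[OF 1(2)]
      have ev: "\<forall>\<^sub>F r in at_top. r \<in> I" using 1(1) by (simp add: eventually_gt_at_top)
      have "0 \<le> 2 * k" by (rule tendsto_lowerbound[OF l[OF ev]]) auto
      moreover have False if k: "k > 0"
      proof -
        have "\<forall>\<^sub>F r in at_top. k < \<bar>deriv u r\<bar> powr p"
          using order_tendstoD(1)[OF l[OF ev]] k by simp
        then obtain s where s: "\<And>r. r \<ge> s \<Longrightarrow> k < \<bar>deriv u r\<bar> powr p"
          by (auto simp: eventually_at_top_linorder)
        define s' where "s' = max s 1"
        define h where "h = k powr (1 / p)"
        have h: "h > 0" using k by (simp add: h_def)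
        \<comment> \<open>A line of slope \<open>- h\<close> starting from \<open>u s'\<close> has
          passed 0 here and reached \<open>- h\<close>.\<close>
        define t where "t = s' + u s' / h + 1"
        have us: "u s' > 0" using pos 1(1) by (auto simp: s'_def)
        then have "s' \<le> t" using h by (simp add: t_def add_nonneg_nonneg)
        have "u t \<le> u s' - h * (t - s')"
        proof (rule u_le_line)
          show "r \<in> I \<and> deriv u r \<le> - h" if "s' < r" for r
          proof -
            have "r \<in> I" "k \<le> \<bar>deriv u r\<bar> powr p"
              using that s[of r] 1(1) by (auto simp: s'_def)
            then show ?thesis using steep[of r k] k by (simp add: h_def)
          qed
        qed (use \<open>s' \<le> t\<close> in \<open>auto simp: s'_def\<close>)
        also have "\<dots> = - h" using h by (simp add: t_def field_simps)
        finally have "u t < 0" using h by simp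
        moreover have "t \<in> I" using \<open>s' \<le> t\<close> 1(1) by (auto simp: s'_def)
        ultimately show False using pos by force
      qed
      ultimately show ?thesis by force
    next
      case (2 R)
      have "(u \<longlongrightarrow> 0) (at R)"
        using DERIV_isCont[OF 2(4)] 2(3) by (simp add: isCont_def)
      then have uR: "(u \<longlongrightarrow> 0) (at_left R)" by (rule filterlim_at_split[THEN iffD1, THEN conjunct1])
      have ev: "\<forall>\<^sub>F r in at_left R. r \<in> I"
        using 2(1,2) eventually_at_left_real[of 0 R] by simp
      note l = lim[OF uR ev]
      have "0 \<le> 2 * k" by (rule tendsto_lowerbound[OF l]) auto
      moreover have False if k: "k > 0"
      proof -
        define h where "h = k powr (1 / p)"
        have h: "h > 0" using k by (simp add: h_def)
        have "\<forall>\<^sub>F r in at_left R. k < \<bar>deriv u r\<bar> powr p"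
          using order_tendstoD(1)[OF l] k by simp
        then obtain s where s: "s < R" "\<And>r. s < r \<Longrightarrow> r < R \<Longrightarrow> k < \<bar>deriv u r\<bar> powr p"
          by (auto simp: eventually_at_left_field)
        define s' where "s' = max s 0"
        have slope: "(u r - u R) / (r - R) \<le> - h" if r: "s' < r" "r < R" for r
        proof -
          have "u R \<le> u r - h * (R - r)"
          proof (rule u_le_line)
            show "x \<in> I \<and> deriv u x \<le> - h" if "r < x" "x < R" for x
              using that s(2)[of x] r 2(2) steep[of x k] k by (auto simp: s'_def h_def)
          qed (use r in \<open>auto simp: s'_def\<close>)
          then show ?thesis
            using r by (simp add: field_simps)
        qed
        have "\<forall>\<^sub>F r in at_left R. (u r - u R) / (r - R) \<le> - h"
          using slope s(1) 2(1) unfolding eventually_at_left_field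
          by (intro exI[of _ s']) (auto simp: s'_def)
        moreover have "((\<lambda>r. (u r - u R) / (r - R)) \<longlongrightarrow> 0) (at_left R)"
          using 2(4) by (simp add: has_field_derivative_iff filterlim_at_split)
        ultimately have "0 \<le> - h"
          by (intro tendsto_upperbound) auto
        then show False using h by simp
      qed
      ultimately show ?thesis by force
    qed
    then show ?thesis using p by (simp add: k_def)
  qed
  then show ?thesis using e[OF assms] by simp
qed

lemma F_nonneg: "r \<in> I \<Longrightarrow> 0 \<le> F (u r)"
  using zero_energy[of r] p by (metis powr_ge_zero zero_le_mult_iff divide_pos_pos diff_gt_0_iff_gt less_trans zero_less_one not_le)

lemma first_order:
  assumes "r \<in> I" shows "deriv u r = - ((p / (p - 1) * F (u r)) powr (1 / p))"
  unfolding zero_energy[OF assms, symmetric] using deriv_nonpos[OF assms] p by (simp add: powr_powr)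

lemma initial_value:
  assumes "(u has_real_derivative 0) (at 0 within {0..})"
  shows "0 < u 0" "F (u 0) = 0"
proof -
  obtain r0 where r0: "r0 \<in> I" using vanishing by (metis dense greaterThanLessThan_iff greaterThan_iff zero_less_one)
  then show u0: "0 < u 0" using pos[OF r0] I_pos[OF r0] antimonoD[of 0 r0] by simp
  have ev: "\<forall>\<^sub>F r in at_right 0. r \<in> I"
    unfolding eventually_at_right_field using r0 I_down[OF r0] I_pos[OF r0] by (intro exI[of _ r0]) auto
  have "(u \<longlongrightarrow> u 0) (at 0 within {0..})"
    using cont by (simp add: continuous_on_def)
  then have "(u \<longlongrightarrow> u 0) (at_right 0)"
    by (simp add: at_within_Ici_at_right)
  then have l: "((\<lambda>r. F (u r)) \<longlongrightarrow> F (u 0)) (at_right 0)"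
    by (rule continuous_on_tendsto_compose[OF F(2)])
      (use ev pos u0 in \<open>auto elim!: eventually_mono intro: less_imp_le\<close>)
  have "0 \<le> F (u 0)"
    by (rule tendsto_lowerbound[OF l]) (use ev F_nonneg in \<open>auto elim!: eventually_mono\<close>)
  moreover have False if c: "0 < F (u 0)"
  proof -
    define k where "k = p / (p - 1) * (F (u 0) / 2)"
    have k: "k > 0" using c p by (simp add: k_def)
    define h where "h = k powr (1 / p)"
    have h: "h > 0" using k by (simp add: h_def)
    have "\<forall>\<^sub>F r in at_right 0. F (u 0) / 2 < F (u r)"
      by (rule order_tendstoD(1)[OF l]) (use c in simp)
    with ev have "\<forall>\<^sub>F r in at_right 0. r \<in> I \<and> F (u 0) / 2 < F (u r)" by eventually_elim simp
    then obtain b where b: "b > 0" "\<And>r. 0 < r \<Longrightarrow> r < b \<Longrightarrow> r \<in> I \<and> F (u 0) / 2 < F (u r)"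
      unfolding eventually_at_right_field by blast
    have "(u r - u 0) / (r - 0) \<le> - h" if r: "0 < r" "r < b" for r
    proof -
      have "u r \<le> u 0 - h * (r - 0)"
      proof (rule u_le_line)
        show "x \<in> I \<and> deriv u x \<le> - h" if "0 < x" "x < r" for x
        proof -
          have x: "x \<in> I" "F (u 0) / 2 < F (u x)" using b(2)[of x] that r by auto
          then have "k \<le> \<bar>deriv u x\<bar> powr p"
            unfolding zero_energy[OF x(1)] k_def using p by (intro mult_left_mono) auto
          then show ?thesis using x(1) steep[of x k] k by (simp add: h_def)
        qed
      qed (use r in auto)
      then show ?thesis using r by (simp add: field_simps)
    qed
    then have "\<forall>\<^sub>F r in at_right 0. (u r - u 0) / (r - 0) \<le> - h"
      unfolding eventually_at_right_field using b(1) by blast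
    moreover have "((\<lambda>r. (u r - u 0) / (r - 0)) \<longlongrightarrow> 0) (at_right 0)"
      using assms by (simp add: has_field_derivative_iff at_within_Ici_at_right)
    ultimately have "0 \<le> - h"
      by (intro tendsto_upperbound) auto
    then show False using h by simp
  qed
  ultimately show "F (u 0) = 0" by force
qed

end

section \<open>Convergence of the solutions\<close>

text \<open>\<open>rate\<close> and \<open>expo\<close> result from solving \<open>(p - 1) / p *
  \<bar>u'\<bar> powr p = u powr (q + 1) / (q + 1)\<close> for \<open>u'\<close>.
  \<open>height\<close> is the positive zero of
  \<open>s powr (q + 1) / (q + 1) - s powr (m + 1) / (m + 1)\<close>.\<close>

definition expo :: "real \<Rightarrow> real \<Rightarrow> real" where "expo p q = (q + 1) / p"
definition rate :: "real \<Rightarrow> real \<Rightarrow> real" where "rate p q = (p / ((p - 1) * (q + 1))) powr (1 / p)"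
definition height :: "real \<Rightarrow> real \<Rightarrow> real" where "height q m = ((m + 1) / (q + 1)) powr (1 / (m - q))"

text \<open>The separated form of the first-order equation: \<open>Psi p q (u r)\<close> has derivative \<open>- rate p q * k\<close>.\<close>

definition Psi :: "real \<Rightarrow> real \<Rightarrow> real \<Rightarrow> real" where
  "Psi p q y = (if expo p q = 1 then ln y else y powr (1 - expo p q) / (1 - expo p q))"

text \<open>For \<open>q \<ge> p - 1\<close> the true limit of \<open>Psi p q\<close> at 0 is minus
  infinity, and the value that the total functions \<open>ln\<close> and \<open>powr\<close> give
  there is meaningless, so 0 is removed.\<close>

definition Psi_dom :: "real \<Rightarrow> real \<Rightarrow> real set" where
  "Psi_dom p q = (if q < p - 1 then {0..} else {0<..})"

text \<open>\<open>k\<close> measures the deviation from the pure power law: it is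
  \<open>slow m\<close> for finite \<open>m\<close> and 1 for the limit problems, so both are
  compared through one predicate.\<close>

definition decay :: "real \<Rightarrow> real \<Rightarrow> (real \<Rightarrow> real) \<Rightarrow> (real \<Rightarrow> real) \<Rightarrow> real set \<Rightarrow> bool" where
  "decay p q k u I \<longleftrightarrow> continuous_on {0..} u \<and> antimono_on {0..} u \<and>
     (\<forall>r\<in>I. 0 < u r \<and> (u has_real_derivative - (rate p q * u r powr expo p q * k (u r))) (at r))"

section \<open>Separation of variables and bounds that are uniform in \<open>m\<close>\<close>

context
  fixes p q :: real
  assumes p: "p > 1" and q: "q \<ge> 0"
begin

lemma expo_pos: "expo p q > 0" and rate_pos: "rate p q > 0"
  using p q by (auto simp: expo_def rate_def)

lemma expo_less_1: "expo p q < 1 \<longleftrightarrow> q < p - 1"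
  using p q by (auto simp: expo_def field_simps)

lemma height_powr: "m > q \<Longrightarrow> height q m powr (m - q) = (m + 1) / (q + 1)"
  using q by (simp add: height_def powr_powr)

lemma height_gt_1:
  assumes "m > q" shows "height q m > 1"
proof -
  have "1 powr (1 / (m - q)) < height q m"
    unfolding height_def using assms q by (intro powr_less_mono2) (auto simp: field_simps)
  then show ?thesis by simp
qed

text \<open>The logarithm of \<open>height q m\<close> is
  \<open>(ln (m + 1) - ln (q + 1)) / (m - q)\<close>; dividing numerator and denominator by
  \<open>m + 1\<close> reduces it to the limit of \<open>ln x / x\<close>.\<close>

lemma height_tendsto: "(height q \<longlongrightarrow> 1) at_top"
proof -
  have top: "filterlim (\<lambda>m::real. m + 1) at_top at_top"
    using filterlim_tendsto_add_at_top[OF tendsto_const filterlim_ident, of 1] by (simp add: add.commute)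
  have r: "((\<lambda>m::real. 1 - (q + 1) / (m + 1)) \<longlongrightarrow> 1 - 0) at_top"
    by (intro tendsto_diff tendsto_const tendsto_divide_0[OF tendsto_const] filterlim_at_top_imp_at_infinity top)
  have "((\<lambda>m::real. (ln (m + 1) / (m + 1) - ln (q + 1) / (m + 1)) / (1 - (q + 1) / (m + 1))) \<longlongrightarrow> (0 - 0) / (1 - 0)) at_top"
    by (intro tendsto_divide tendsto_diff r filterlim_compose[OF ln_x_over_x_tendsto_0 top]
        tendsto_divide_0[OF tendsto_const] filterlim_at_top_imp_at_infinity top) auto
  then have "((\<lambda>m::real. exp ((ln (m + 1) / (m + 1) - ln (q + 1) / (m + 1)) / (1 - (q + 1) / (m + 1)))) \<longlongrightarrow> 1) at_top"
    using tendsto_exp by fastforce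
  then show ?thesis
  proof (rule Lim_transform_eventually)
    show "\<forall>\<^sub>F m in at_top. exp ((ln (m + 1) / (m + 1) - ln (q + 1) / (m + 1)) / (1 - (q + 1) / (m + 1))) = height q m"
      using eventually_gt_at_top[of q]
    proof eventually_elim
      case (elim m)
      have "1 - (q + 1) / (m + 1) = (m - q) / (m + 1)"
        using elim q by (simp add: field_simps)
      then have "(ln (m + 1) / (m + 1) - ln (q + 1) / (m + 1)) / (1 - (q + 1) / (m + 1)) = 1 / (m - q) * (ln (m + 1) - ln (q + 1))"
        using elim q by (simp flip: diff_divide_distrib)
      then show ?case
        using elim q by (simp add: height_def powr_def ln_div)
    qed
  qed
qed

lemma DERIV_Psi:
  assumes "y > 0" shows "(Psi p q has_real_derivative y powr (- expo p q)) (at y)"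
proof (cases "expo p q = 1")
  case True
  then show ?thesis
    using assms unfolding Psi_def[abs_def]
    by (auto intro!: derivative_eq_intros simp: powr_minus divide_inverse)
next
  case False
  have "((\<lambda>y. y powr (1 - expo p q)) has_real_derivative (1 - expo p q) * y powr (- expo p q)) (at y)"
    using assms by (auto intro!: derivative_eq_intros)
  from DERIV_cdivide[OF this, of "1 - expo p q"] show ?thesis
    using False by (simp add: Psi_def[abs_def])
qed

lemma isCont_Psi: "y > 0 \<Longrightarrow> isCont (Psi p q) y"
  using DERIV_Psi DERIV_isCont by blast

lemma continuous_on_Psi: "continuous_on (Psi_dom p q) (Psi p q)"
proof (cases "q < p - 1")
  case True
  then have "expo p q < 1" by (simp add: expo_less_1)
  then have "continuous_on {0..} (\<lambda>y. y powr (1 - expo p q) / (1 - expo p q))"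
    by (intro continuous_on_divide continuous_on_powr' continuous_intros) auto
  then show ?thesis
    using True \<open>expo p q < 1\<close> by (simp add: Psi_def[abs_def] Psi_dom_def)
next
  case False
  then show ?thesis
    using isCont_Psi by (auto simp: Psi_dom_def intro: continuous_at_imp_continuous_on)
qed

lemma Psi_strict_mono: "x \<in> Psi_dom p q \<Longrightarrow> x < y \<Longrightarrow> Psi p q x < Psi p q y"
proof (rule DERIV_pos_imp_increasing_open[of x y "Psi p q"])
  assume x: "x \<in> Psi_dom p q" and "x < y"
  then have nn: "0 \<le> x" and sub: "{x..y} \<subseteq> Psi_dom p q" by (auto simp: Psi_dom_def split: if_splits)
  show "\<exists>d. (Psi p q has_real_derivative d) (at z) \<and> 0 < d" if "x < z" "z < y" for z
    using DERIV_Psi[of z] nn that by (intro exI conjI) auto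
  show "continuous_on {x..y} (Psi p q)"
    by (rule continuous_on_subset[OF continuous_on_Psi sub])
qed

text \<open>Along a solution \<open>Psi p q (u r)\<close> has slope
  \<open>- (rate p q * k (u r))\<close>, so bounds on \<open>k\<close> become linear bounds. Only
  the last value has to be known to lie in the domain: earlier values are at least as large, since
  \<open>u\<close> is non-increasing.\<close>

lemma decay_line:
  assumes d: "decay p q k u I" and st: "0 \<le> s" "s \<le> t" "{s<..<t} \<subseteq> I" "u t \<in> Psi_dom p q"
  shows "(\<And>r. s < r \<Longrightarrow> r < t \<Longrightarrow> k0 \<le> k (u r)) \<Longrightarrow> Psi p q (u t) \<le> Psi p q (u s) - rate p q * k0 * (t - s)"
    and "(\<And>r. s < r \<Longrightarrow> r < t \<Longrightarrow> k (u r) \<le> 1) \<Longrightarrow> Psi p q (u s) - rate p q * (t - s) \<le> Psi p q (u t)"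
proof -
  have "u ` {s..t} \<subseteq> Psi_dom p q"
  proof
    fix y assume "y \<in> u ` {s..t}"
    then have "u t \<le> y" using d st by (auto simp: decay_def monotone_on_def)
    then show "y \<in> Psi_dom p q" using st(4) by (auto simp: Psi_dom_def split: if_splits)
  qed
  moreover have "continuous_on {s..t} u"
    using d st by (auto simp: decay_def intro: continuous_on_subset)
  ultimately have c: "continuous_on {s..t} (\<lambda>r. Psi p q (u r))"
    by (intro continuous_on_compose2[OF continuous_on_Psi])
  have der: "((\<lambda>r. Psi p q (u r)) has_real_derivative - (rate p q * k (u r))) (at r)" if "s < r" "r < t" for r
  proof -
    have r: "r \<in> I" using that st by auto
    then have u: "0 < u r" "(u has_real_derivative - (rate p q * u r powr expo p q * k (u r))) (at r)"
      using d by (auto simp: decay_def)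
    have "((\<lambda>r. Psi p q (u r)) has_real_derivative u r powr (- expo p q) * - (rate p q * u r powr expo p q * k (u r))) (at r)"
      by (rule DERIV_chain2[OF DERIV_Psi[OF u(1)] u(2)])
    moreover have "u r powr (- expo p q) * - (rate p q * u r powr expo p q * k (u r)) = - (rate p q * k (u r))"
      using u(1) by (simp add: powr_minus)
    ultimately show ?thesis by (simp only:)
  qed
  show "Psi p q (u t) \<le> Psi p q (u s) - rate p q * k0 * (t - s)" if "\<And>r. s < r \<Longrightarrow> r < t \<Longrightarrow> k0 \<le> k (u r)"
  proof -
    have "\<exists>D\<le>- (rate p q * k0). ((\<lambda>r. Psi p q (u r)) has_real_derivative D) (at r)" if r: "s < r" "r < t" for r
      using der[OF r] \<open>\<And>r. s < r \<Longrightarrow> r < t \<Longrightarrow> k0 \<le> k (u r)\<close>[OF r] rate_pos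
      by (intro exI[of _ "- (rate p q * k (u r))"]) auto
    from le_if_derivative_le[OF st(2) c this] show ?thesis by simp
  qed
  show "Psi p q (u s) - rate p q * (t - s) \<le> Psi p q (u t)" if "\<And>r. s < r \<Longrightarrow> r < t \<Longrightarrow> k (u r) \<le> 1"
  proof -
    have "\<exists>D\<le>rate p q. ((\<lambda>r. - Psi p q (u r)) has_real_derivative D) (at r)" if r: "s < r" "r < t" for r
      using DERIV_minus[OF der[OF r]] \<open>\<And>r. s < r \<Longrightarrow> r < t \<Longrightarrow> k (u r) \<le> 1\<close>[OF r] rate_pos
      by (intro exI[of _ "rate p q * k (u r)"]) auto
    from le_if_derivative_le[OF st(2) continuous_on_minus[OF c] this] show ?thesis by simp
  qed
qed

definition slow :: "real \<Rightarrow> real \<Rightarrow> real" where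
  "slow m y = (1 - (y / height q m) powr (m - q)) powr (1 / p)"

lemma powr_le_self:
  fixes x :: real
  assumes "0 \<le> x" "x \<le> 1" "1 \<le> b" shows "x powr b \<le> x"
  using assms powr_mono'[of 1 b x] by (cases "x = 0") auto

text \<open>Near its maximum, \<open>1 - u / a\<close> satisfies \<open>y' \<ge> c y^(1/p)\<close> with \<open>c\<close> independent of \<open>m\<close>,
  which forces \<open>u\<close> away from the maximum.\<close>

lemma leaves_maximum:
  assumes d: "decay p q (slow m) u I" and u0: "u 0 = height q m" and m: "m \<ge> q + 1" and h2: "height q m < 2"
    and lt: "\<And>s. s \<in> I \<Longrightarrow> u s < height q m" and r: "0 < r" "{0<..r} \<subseteq> I"
  defines "c \<equiv> rate p q / 2 * (1 / 2) powr expo p q * (1 - 1 / p)"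
  shows "u r / height q m \<le> 1 - min (1 / 2) ((c * r) powr (p / (p - 1)))"
proof (cases "u r / height q m \<le> 1 / 2")
  case False
  define a where "a = height q m"
  have a: "1 < a" "a < 2" using height_gt_1[of m] m h2 by (auto simp: a_def)
  have c: "c > 0" using rate_pos p by (simp add: c_def)
  define y where "y = (\<lambda>s. 1 - u s / a)"
  have yp: "0 < y s" if "s \<in> I" for s using lt[OF that] a by (simp add: y_def a_def)
  have cu: "continuous_on {0..r} u" using d by (auto simp: decay_def intro: continuous_on_subset)
  have yb: "0 \<le> y s" if "s \<in> {0..r}" for s
    using yp[of s] that r(2) u0 a by (cases "s = 0") (auto simp: y_def a_def subset_eq intro: less_imp_le)
  have cy: "continuous_on {0..r} (\<lambda>s. - (y s powr (1 - 1 / p)))"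
    using p yb a by (intro continuous_on_minus continuous_on_powr' continuous_intros)
      (auto simp: y_def intro!: continuous_intros cu)
  \<comment> \<open>The power \<open>1 - 1 / p\<close> linearises the differential inequality for
    \<open>y\<close>. In \<open>c\<close>, the division of \<open>rate p q\<close> by 2 accounts for
    \<open>a < 2\<close>, and \<open>(1 / 2) powr expo p q\<close> for \<open>u > 1/2\<close> on the
    interval.\<close>
  have "- (y r powr (1 - 1 / p)) \<le> - (y 0 powr (1 - 1 / p)) + (- c) * (r - 0)"
  proof (rule le_if_derivative_le[OF _ cy])
    fix s assume s: "0 < s" "s < r"
    then have sI: "s \<in> I" using r by auto
    define D where "D = rate p q * u s powr expo p q * slow m (u s)"
    have du: "(u has_real_derivative - D) (at s)" and us: "0 < u s" using d sI by (auto simp: decay_def D_def)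
    have dy: "(y has_real_derivative D / a) (at s)"
      unfolding y_def using a by (auto intro!: derivative_eq_intros du)
    have "((\<lambda>s. y s powr (1 - 1 / p)) has_real_derivative (1 - 1 / p) * y s powr (1 - 1 / p - 1) * (D / a)) (at s)"
      using yp[OF sI] by (auto intro!: derivative_eq_intros dy)
    from DERIV_minus[OF this]
    have der: "((\<lambda>s. - (y s powr (1 - 1 / p))) has_real_derivative - ((1 - 1 / p) * y s powr (- (1 / p)) * (D / a))) (at s)"
      by simp
    have "u r \<le> u s" using d s by (auto simp: decay_def monotone_on_def)
    moreover have "1 / 2 < u r" using False a by (simp add: a_def[symmetric] field_simps)
    ultimately have "(1 / 2) powr expo p q \<le> u s powr expo p q"
      using expo_pos by (intro powr_mono2) auto
    moreover have "y s powr (1 / p) \<le> slow m (u s)"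
    proof -
      \<comment> \<open>Here \<open>m \<ge> q + 1\<close> enters: an exponent of at least 1 does not
        increase numbers in \<open>[0, 1]\<close>, which removes \<open>m\<close> from the
        estimate.\<close>
      have "(u s / a) powr (m - q) \<le> u s / a"
        using us a lt[OF sI] m by (intro powr_le_self) (auto simp: a_def)
      then show ?thesis
        unfolding slow_def a_def[symmetric] using yp[OF sI] p by (intro powr_mono2) (auto simp: y_def)
    qed
    ultimately have "rate p q * (1 / 2) powr expo p q * y s powr (1 / p) \<le> D"
      unfolding D_def using rate_pos by (intro mult_mono) auto
    then have "rate p q * (1 / 2) powr expo p q * y s powr (1 / p) / 2 \<le> D / a"
      using a rate_pos by (intro frac_le) (auto simp: D_def slow_def)
    then have "(1 - 1 / p) * y s powr (- (1 / p)) * (rate p q * (1 / 2) powr expo p q * y s powr (1 / p) / 2)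
        \<le> (1 - 1 / p) * y s powr (- (1 / p)) * (D / a)"
      using p by (intro mult_left_mono) auto
    moreover have "(1 - 1 / p) * y s powr (- (1 / p)) * (rate p q * (1 / 2) powr expo p q * y s powr (1 / p) / 2) = c"
      using yp[OF sI] by (simp add: c_def powr_minus)
    ultimately have "- ((1 - 1 / p) * y s powr (- (1 / p)) * (D / a)) \<le> - c" by linarith
    with der show "\<exists>D\<le>- c. ((\<lambda>s. - (y s powr (1 - 1 / p))) has_real_derivative D) (at s)" by blast
  qed (use r in simp)
  moreover have "y 0 = 0" using u0 a by (simp add: y_def a_def)
  ultimately have "c * r \<le> y r powr (1 - 1 / p)" by simp
  then have "(c * r) powr (p / (p - 1)) \<le> (y r powr (1 - 1 / p)) powr (p / (p - 1))"
    using c r p by (intro powr_mono2) auto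
  also have "\<dots> = y r"
    using yb[of r] r p by (simp add: powr_powr field_simps)
  finally show ?thesis by (simp add: y_def a_def)
next
  case True
  then show ?thesis using min.cobounded1[of "1 / 2"] by (smt (verit) field_sum_of_halves)
qed

lemma tendsto_slow_factor:
  assumes "0 < \<delta>" "\<delta> < 1"
  shows "((\<lambda>m. (1 - (1 - \<delta>) powr (m - q)) powr (1 / p)) \<longlongrightarrow> 1) at_top"
proof -
  have "filterlim (\<lambda>m::real. m - q) at_top at_top"
    using filterlim_tendsto_add_at_top[OF tendsto_const filterlim_ident, of "- q"] by simp
  then have "filterlim (\<lambda>m. ln (1 - \<delta>) * (m - q)) at_bot at_top"
    using assms by (intro filterlim_tendsto_neg_mult_at_bot[OF tendsto_const]) auto
  then have "((\<lambda>m. exp (ln (1 - \<delta>) * (m - q))) \<longlongrightarrow> 0) at_top"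
    by (rule filterlim_compose[OF exp_at_bot])
  then have "((\<lambda>m. (1 - \<delta>) powr (m - q)) \<longlongrightarrow> 0) at_top"
    using assms by (simp add: powr_def mult.commute)
  then have "((\<lambda>m. (1 - (1 - \<delta>) powr (m - q)) powr (1 / p)) \<longlongrightarrow> (1 - 0) powr (1 / p)) at_top"
    by (intro tendsto_intros) auto
  then show ?thesis by simp
qed

text \<open>At a free boundary point \<open>t\<close> the interval is exhausted and \<open>u t = 0\<close>; this is allowed because \<open>Psi\<close> is
  then continuous at 0.\<close>

definition reaches :: "(real \<Rightarrow> real) \<Rightarrow> real set \<Rightarrow> real \<Rightarrow> bool" where
  "reaches u I t \<longleftrightarrow> 0 < t \<and> {0<..<t} \<subseteq> I \<and> u t \<in> Psi_dom p q"

context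
  fixes u :: "real \<Rightarrow> real \<Rightarrow> real" and I :: "real \<Rightarrow> real set"
  assumes dec: "\<And>m. m > q \<Longrightarrow> decay p q (slow m) (u m) (I m)"
    and u0: "\<And>m. m > q \<Longrightarrow> u m 0 = height q m"
    and lt: "\<And>m r. m > q \<Longrightarrow> r \<in> I m \<Longrightarrow> u m r < height q m"
begin

lemma family_lower:
  assumes m: "m > q" and t: "reaches (u m) (I m) t"
  shows "Psi p q (height q m) - rate p q * t \<le> Psi p q (u m t)"
proof -
  have "slow m (u m r) \<le> 1" if "0 < r" "r < t" for r
  proof -
    have "r \<in> I m" using t that by (auto simp: reaches_def)
    then have "0 < u m r" "u m r < height q m" using dec[OF m] lt[OF m] by (auto simp: decay_def)
    then have "(u m r / height q m) powr (m - q) \<le> 1"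
      using m by (intro powr_le1) auto
    then show ?thesis
      unfolding slow_def using p by (intro powr_le1) auto
  qed
  then show ?thesis
    using decay_line(2)[OF dec[OF m], of 0 t] t u0[OF m] by (auto simp: reaches_def)
qed

text \<open>From \<open>r0\<close> on, the ratio of \<open>u m\<close> to its maximum is at most
  \<open>1 - \<delta>\<close> with \<open>\<delta>\<close> independent of \<open>m\<close>, so
  \<open>slow m\<close> is at least a number \<open>k m\<close> that tends to 1. The bound is
  uniform in \<open>t\<close>, as it is later applied at \<open>t = R m\<close>, which moves with
  \<open>m\<close>.\<close>

lemma family_upper:
  assumes r0: "r0 > 0"
  obtains k where "(k \<longlongrightarrow> 1) at_top" and "\<forall>\<^sub>F m in at_top. \<forall>t>r0. reaches (u m) (I m) t \<longrightarrow>
      Psi p q (u m t) \<le> Psi p q (height q m) - rate p q * k m * (t - r0)"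
proof -
  define c where "c = rate p q / 2 * (1 / 2) powr expo p q * (1 - 1 / p)"
  define \<delta> where "\<delta> = min (1 / 2) ((c * r0) powr (p / (p - 1)))"
  have "c > 0" using rate_pos p by (simp add: c_def)
  then have \<delta>: "0 < \<delta>" "\<delta> < 1" using r0 by (auto simp: \<delta>_def)
  define k where "k = (\<lambda>m. (1 - (1 - \<delta>) powr (m - q)) powr (1 / p))"
  show ?thesis
  proof (rule that[of k])
    show "(k \<longlongrightarrow> 1) at_top" unfolding k_def by (rule tendsto_slow_factor[OF \<delta>])
    have "\<forall>\<^sub>F m in at_top. height q m < 2"
      using order_tendstoD(2)[OF height_tendsto, of 2] by simp
    then show "\<forall>\<^sub>F m in at_top. \<forall>t>r0. reaches (u m) (I m) t \<longrightarrow>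
      Psi p q (u m t) \<le> Psi p q (height q m) - rate p q * k m * (t - r0)"
      using eventually_ge_at_top[of "q + 1"]
    proof eventually_elim
      case (elim m)
      then have m: "m > q" by simp
      let ?a = "height q m"
      have a: "1 < ?a" by (rule height_gt_1[OF m])
      show ?case
      proof (intro allI impI)
        fix t assume t: "r0 < t" "reaches (u m) (I m) t"
        have r0I: "{0<..r0} \<subseteq> I m" using t by (auto simp: reaches_def)
        have ur0: "u m r0 / ?a \<le> 1 - \<delta>"
          unfolding \<delta>_def c_def by (rule leaves_maximum[OF dec[OF m] u0[OF m] elim(2,1) lt[OF m] r0 r0I])
        have anti: "u m r \<le> u m r0" if "r0 \<le> r" for r
          using dec[OF m] r0 that by (auto simp: decay_def monotone_on_def)
        have "Psi p q (u m t) \<le> Psi p q (u m r0) - rate p q * k m * (t - r0)"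
        proof (rule decay_line(1)[OF dec[OF m]])
          fix r assume r: "r0 < r" "r < t"
          then have "r \<in> I m" using t r0 by (auto simp: reaches_def)
          then have "0 < u m r" using dec[OF m] by (auto simp: decay_def)
          moreover have "u m r / ?a \<le> 1 - \<delta>"
            using anti[of r] r a ur0 by (auto intro: order_trans[OF divide_right_mono])
          ultimately have "(u m r / ?a) powr (m - q) \<le> (1 - \<delta>) powr (m - q)"
            using m a by (intro powr_mono2) auto
          then show "k m \<le> slow m (u m r)"
            unfolding k_def slow_def using p m \<delta> by (intro powr_mono2) (auto intro!: powr_le1)
        qed (use t r0 in \<open>auto simp: reaches_def\<close>)
        also have "Psi p q (u m r0) \<le> Psi p q ?a"
        proof -
          have "0 < u m r0" "u m r0 < ?a" using r0I r0 dec[OF m] lt[OF m] by (auto simp: decay_def)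
          then show ?thesis using Psi_strict_mono[of "u m r0" ?a] by (auto simp: Psi_dom_def intro: less_imp_le)
        qed
        finally show "Psi p q (u m t) \<le> Psi p q ?a - rate p q * k m * (t - r0)" by simp
      qed
    qed
  qed
qed

end

end

text \<open>The vanishing slope at 0 gives \<open>F (u 0) = 0\<close>, and \<open>a\<close> is the
  only positive zero of \<open>F\<close>. Factoring \<open>F\<close> as
  \<open>s powr (q + 1) / (q + 1)\<close> times \<open>1 - (s / a) powr (m - q)\<close> brings the
  first-order equation into the form with \<open>slow\<close>.\<close>

lemma power_profile:
  assumes P: "profile p u (\<lambda>s. s powr q - s powr m) (\<lambda>s. s powr (q + 1) / (q + 1) - s powr (m + 1) / (m + 1)) I"
    and d0: "(u has_real_derivative 0) (at 0 within {0..})" and q: "q \<ge> 0" and m: "m > q"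
  shows "decay p q (slow p q m) u I" and "u 0 = height q m" and "r \<in> I \<Longrightarrow> u r < height q m"
proof -
  define F where "F = (\<lambda>s::real. s powr (q + 1) / (q + 1) - s powr (m + 1) / (m + 1))"
  interpret profile p u "\<lambda>s. s powr q - s powr m" F I
    using P by (simp add: F_def)
  define a where "a = height q m"
  have a: "a > 1" unfolding a_def by (rule height_gt_1[OF p q m])
  have am: "a powr (m - q) = (m + 1) / (q + 1)" unfolding a_def by (rule height_powr[OF p q m])
  have Fs: "F s = s powr (q + 1) / (q + 1) * (1 - (s / a) powr (m - q))" if "s > 0" for s
  proof -
    have "s powr (m + 1) = s powr (q + 1) * s powr (m - q)"
      by (subst powr_add[symmetric]) (simp add: add.commute)
    then show ?thesis
      using q m that a by (simp add: F_def powr_divide am field_simps)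
  qed
  have le: "s \<le> a" if "s > 0" "F s \<ge> 0" for s
  proof (rule ccontr)
    assume "\<not> s \<le> a"
    then have "1 powr (m - q) < (s / a) powr (m - q)" using a m by (intro powr_less_mono2) auto
    then have "F s < 0" unfolding Fs[OF that(1)] using that q by (intro mult_pos_neg) auto
    then show False using that by simp
  qed
  have "u 0 > 0" and F0: "F (u 0) = 0" using initial_value[OF d0] by auto
  then have one: "(u 0 / a) powr (m - q) = 1" using Fs[of "u 0"] q by simp
  have "\<not> u 0 < a"
  proof
    assume "u 0 < a"
    then have "(u 0 / a) powr (m - q) < 1 powr (m - q)"
      using \<open>u 0 > 0\<close> a m by (intro powr_less_mono2) auto
    then show False using one by simp
  qed
  then have u0: "u 0 = a" using le[of "u 0"] \<open>u 0 > 0\<close> F0 by simp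
  then show "u 0 = height q m" by (simp add: a_def)
  have ule: "u r \<le> a" if "r \<in> I" for r
    using le[OF pos[OF that] F_nonneg[OF that]] .
  show "decay p q (slow p q m) u I"
    unfolding decay_def
  proof (intro conjI ballI cont anti)
    fix r assume r: "r \<in> I"
    show "0 < u r" using pos[OF r] .
    have "(u r / a) powr (m - q) \<le> 1" using ule[OF r] pos[OF r] a m by (intro powr_le1) auto
    then have nn: "0 \<le> 1 - (u r / a) powr (m - q)" by simp
    have c: "0 \<le> p / ((p - 1) * (q + 1))" using p q by simp
    have "p / (p - 1) * F (u r) = p / ((p - 1) * (q + 1)) * (u r powr (q + 1) * (1 - (u r / a) powr (m - q)))"
      using p q by (simp add: Fs[OF pos[OF r]])
    then have "(p / (p - 1) * F (u r)) powr (1 / p) =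
        (p / ((p - 1) * (q + 1))) powr (1 / p) *
        ((u r powr (q + 1)) powr (1 / p) * (1 - (u r / a) powr (m - q)) powr (1 / p))"
      using c nn by (simp only: powr_mult powr_ge_zero mult_nonneg_nonneg)
    also have "\<dots> = rate p q * (u r powr expo p q * slow p q m (u r))"
      by (simp add: powr_powr rate_def expo_def slow_def[OF p q] a_def)
    finally show "(u has_real_derivative - (rate p q * u r powr expo p q * slow p q m (u r))) (at r)"
      using DERIV_u[OF r] first_order[OF r] by (simp add: mult.assoc)
  qed
  show "u r < height q m" if r: "r \<in> I"
  proof (rule ccontr)
    assume "\<not> u r < height q m"
    then have "u r = a" using ule[OF r] by (simp add: a_def)
    \<comment> \<open>Monotonicity would make \<open>u\<close> equal to \<open>a\<close> on all of
      \<open>[0, r]\<close>. The flux then vanishes inside, and the equation reads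
      \<open>a powr q = a powr m\<close>, impossible for \<open>a > 1\<close> and
      \<open>m > q\<close>.\<close>
    have ua: "u s = a" if "0 \<le> s" "s \<le> r" for s
      using antimonoD[of 0 s] antimonoD[of s r] that u0 \<open>u r = a\<close> by simp
    have fl: "plap_flux p u s = 0" if "s \<in> {0<..<r}" for s
    proof -
      have s: "s \<in> I" using I_down[OF r] that by auto
      have "u s = u 0" using ua[of s] u0 that by simp
      then have "deriv u s = 0" using first_order[OF s] F0 by simp
      then show ?thesis by (simp add: plap_flux_def)
    qed
    have r2: "r / 2 \<in> {0<..<r}" "r / 2 \<in> I" using I_pos[OF r] I_down[OF r, of "r / 2"] by auto
    have "(plap_flux p u has_real_derivative 0) (at (r / 2))"
      by (rule has_field_derivative_transform_within_open[of "\<lambda>_. 0" _ _ "{0<..<r}"]) (use fl r2 in auto)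
    then have "plap p u (r / 2) = 0" unfolding plap_def by (rule DERIV_imp_deriv)
    then have "a powr q = a powr m" using eq[OF r2(2)] ua[of "r / 2"] I_pos[OF r] by simp
    then show False using powr_less_mono[OF m, of a] a by simp
  qed
qed

lemma limit_profile:
  assumes P: "profile p u (\<lambda>s. s powr q) (\<lambda>s. s powr (q + 1) / (q + 1)) I" and q: "q \<ge> 0"
  shows "decay p q (\<lambda>_. 1) u I"
proof -
  interpret profile p u "\<lambda>s. s powr q" "\<lambda>s. s powr (q + 1) / (q + 1)" I by (rule P)
  show ?thesis
    unfolding decay_def
  proof (intro conjI ballI cont anti)
    fix r assume r: "r \<in> I"
    show "0 < u r" using pos[OF r] .
    have c: "0 \<le> p / ((p - 1) * (q + 1))" using p q by simp
    have "p / (p - 1) * (u r powr (q + 1) / (q + 1)) = p / ((p - 1) * (q + 1)) * u r powr (q + 1)"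
      by simp
    then have "(p / (p - 1) * (u r powr (q + 1) / (q + 1))) powr (1 / p) = rate p q * u r powr expo p q"
      using c by (simp only: powr_mult powr_ge_zero) (simp add: powr_powr rate_def expo_def)
    then show "(u has_real_derivative - (rate p q * u r powr expo p q * 1)) (at r)"
      using DERIV_u[OF r] first_order[OF r] by simp
  qed
qed

section \<open>The four boundary value problems as instances of \<open>profile\<close>\<close>

lemma power_potential:
  assumes "(b::real) > 0"
  shows "s > 0 \<Longrightarrow> ((\<lambda>s. s powr b / b) has_real_derivative s powr (b - 1)) (at s)"
    and "continuous_on {0..} (\<lambda>s::real. s powr b / b)"
proof -
  show "((\<lambda>s. s powr b / b) has_real_derivative s powr (b - 1)) (at s)" if "s > 0"
  proof -
    have "((\<lambda>s. s powr b) has_real_derivative b * s powr (b - 1)) (at s)"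
      using that by (auto intro!: derivative_eq_intros)
    from DERIV_cdivide[OF this, of b] show ?thesis using assms by simp
  qed
  show "continuous_on {0..} (\<lambda>s::real. s powr b / b)"
    using assms by (intro continuous_on_divide continuous_on_powr' continuous_on_id continuous_on_const) auto
qed

lemma FBP_profile:
  assumes "antimono_on {0..} u" "FBP p q m u R" "p > 1" "q \<ge> 0" "m > q"
  shows "profile p u (\<lambda>s. s powr q - s powr m) (\<lambda>s. s powr (q + 1) / (q + 1) - s powr (m + 1) / (m + 1)) {0<..<R}"
proof
  show "((\<lambda>s. s powr (q + 1) / (q + 1) - s powr (m + 1) / (m + 1)) has_real_derivative s powr q - s powr m) (at s)" if "s > 0" for s
    using DERIV_diff[OF power_potential(1)[of "q + 1" s] power_potential(1)[of "m + 1" s]] assms that by simp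
  show "continuous_on {0..} (\<lambda>s. s powr (q + 1) / (q + 1) - s powr (m + 1) / (m + 1))"
    using assms by (intro continuous_on_diff power_potential) auto
qed (use assms in \<open>auto simp: FBP_def plap_regular_def free_boundary_at_def eq_diff_eq\<close>)

lemma Prob_profile:
  assumes "antimono_on {0..} u" "Prob p q m u" "p > 1" "q \<ge> 0" "m > q"
  shows "profile p u (\<lambda>s. s powr q - s powr m) (\<lambda>s. s powr (q + 1) / (q + 1) - s powr (m + 1) / (m + 1)) {0<..}"
proof
  show "((\<lambda>s. s powr (q + 1) / (q + 1) - s powr (m + 1) / (m + 1)) has_real_derivative s powr q - s powr m) (at s)" if "s > 0" for s
    using DERIV_diff[OF power_potential(1)[of "q + 1" s] power_potential(1)[of "m + 1" s]] assms that by simp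
  show "continuous_on {0..} (\<lambda>s. s powr (q + 1) / (q + 1) - s powr (m + 1) / (m + 1))"
    using assms by (intro continuous_on_diff power_potential) auto
qed (use assms in \<open>auto simp: Prob_def plap_regular_def eq_diff_eq\<close>)

lemma FBP_inf_profile:
  assumes "antimono_on {0..} u" "FBP_inf p q u R" "p > 1" "q \<ge> 0"
  shows "profile p u (\<lambda>s. s powr q) (\<lambda>s. s powr (q + 1) / (q + 1)) {0<..<R}"
proof
  show "((\<lambda>s. s powr (q + 1) / (q + 1)) has_real_derivative s powr q) (at s)" if "s > 0" for s
    using power_potential(1)[of "q + 1" s] assms that by simp
  show "continuous_on {0..} (\<lambda>s. s powr (q + 1) / (q + 1))"
    using assms by (intro power_potential) auto
qed (use assms in \<open>auto simp: FBP_inf_def plap_regular_def free_boundary_at_def\<close>)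

lemma Prob_inf_profile:
  assumes "antimono_on {0..} u" "Prob_inf p q u" "p > 1" "q \<ge> 0"
  shows "profile p u (\<lambda>s. s powr q) (\<lambda>s. s powr (q + 1) / (q + 1)) {0<..}"
proof
  show "((\<lambda>s. s powr (q + 1) / (q + 1)) has_real_derivative s powr q) (at s)" if "s > 0" for s
    using power_potential(1)[of "q + 1" s] assms that by simp
  show "continuous_on {0..} (\<lambda>s. s powr (q + 1) / (q + 1))"
    using assms by (intro power_potential) auto
qed (use assms in \<open>auto simp: Prob_inf_def plap_regular_def\<close>)

text \<open>Everything is compared after applying \<open>Psi\<close>: the limit becomes the line
  \<open>Psi p q 1 - rate p q * t\<close>, and \<open>u m\<close> is squeezed between lines related
  to \<open>Psi p q (height q m)\<close>. Strict monotonicity of \<open>Psi\<close> carries the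
  inequalities back.\<close>

lemma solution_limits:
  fixes u :: "real \<Rightarrow> real \<Rightarrow> real"
  assumes p: "p > 1" and q: "q \<ge> 0"
    and u: "\<And>m. m > q \<Longrightarrow>
          antimono_on {0..} (u m) \<and> (if q < p - 1 then FBP p q m (u m) (R m) else Prob p q m (u m))"
    and uinf: "antimono_on {0..} uinf \<and> (if q < p - 1 then FBP_inf p q uinf Rinf else Prob_inf p q uinf)"
  shows "q < p - 1 \<Longrightarrow> (R \<longlongrightarrow> Rinf) at_top"
    and "r > 0 \<Longrightarrow> ((\<lambda>m. u m r) \<longlongrightarrow> uinf r) at_top"
proof -
  define I where "I = (\<lambda>m. if q < p - 1 then {0<..<R m} else {0<..})"
  define J where "J = (if q < p - 1 then {0<..<Rinf} else {0<..})"
  let ?P = "Psi p q" and ?c = "rate p q" and ?a = "height q"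
  have c: "?c > 0" by (rule rate_pos[OF p q])
  have prof: "profile p (u m) (\<lambda>s. s powr q - s powr m) (\<lambda>s. s powr (q + 1) / (q + 1) - s powr (m + 1) / (m + 1)) (I m)"
    and d0: "(u m has_real_derivative 0) (at 0 within {0..})" if "m > q" for m
    using u[OF that] FBP_profile[of "u m" p q m "R m"] Prob_profile[of "u m" p q m] p q that
    by (auto simp: I_def FBP_def Prob_def split: if_splits)
  have dec: "decay p q (slow p q m) (u m) (I m)" and u0: "u m 0 = ?a m"
    and lt: "\<And>r. r \<in> I m \<Longrightarrow> u m r < ?a m" if "m > q" for m
    using power_profile[OF prof[OF that] d0[OF that] q that] by auto
  have profJ: "profile p uinf (\<lambda>s. s powr q) (\<lambda>s. s powr (q + 1) / (q + 1)) J" and uinf0: "uinf 0 = 1"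
    using uinf FBP_inf_profile[of uinf p q Rinf] Prob_inf_profile[of uinf p q] p q
    by (auto simp: J_def FBP_inf_def Prob_inf_def split: if_splits)
  have decJ: "decay p q (\<lambda>_. 1) uinf J" by (rule limit_profile[OF profJ q])
  have fb: "0 < R m" "u m t = 0 \<longleftrightarrow> R m \<le> t" "0 \<le> u m t" if "q < p - 1" "m > q" "t \<ge> 0" for m t
    using u[OF that(2)] that by (auto simp: FBP_def free_boundary_at_def intro: le_less_linear)
       (metis atLeastLessThan_iff less_irrefl not_le, metis atLeastLessThan_iff less_imp_le not_le order_refl)
  have fbi: "0 < Rinf" "uinf t = 0 \<longleftrightarrow> Rinf \<le> t" "0 \<le> uinf t" if "q < p - 1" "t \<ge> 0" for t
    using uinf that by (auto simp: FBP_inf_def free_boundary_at_def intro: le_less_linear)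
       (metis atLeastLessThan_iff less_irrefl not_le, metis atLeastLessThan_iff less_imp_le not_le order_refl)
  have reach: "reaches p q (u m) (I m) t" if "m > q" "t > 0" "q < p - 1 \<Longrightarrow> t \<le> R m" for m t
    using that fb[of m t] u[OF that(1)] unfolding reaches_def[OF p q] I_def Psi_dom_def Prob_def by auto
  \<comment> \<open>With \<open>k = 1\<close> the upper and the lower line coincide, so the limit is
    known explicitly.\<close>
  have limP: "?P (uinf t) = ?P 1 - ?c * t" if "t > 0" "q < p - 1 \<Longrightarrow> t \<le> Rinf" for t
  proof -
    have "{0<..<t} \<subseteq> J" "uinf t \<in> Psi_dom p q"
      using that fbi[of t] uinf unfolding J_def Psi_dom_def Prob_inf_def by auto
    then show ?thesis
      using decay_line(1)[OF p q decJ, of 0 t 1] decay_line(2)[OF p q decJ, of 0 t] that(1) uinf0 by simp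
  qed
  have Pa: "((\<lambda>m. ?P (?a m)) \<longlongrightarrow> ?P 1) at_top"
    using isCont_tendsto_compose[OF isCont_Psi[OF p q, of 1] height_tendsto[OF p q]] by simp
  note mono = Psi_strict_mono[OF p q]
  have lower: "?P (?a m) - ?c * t \<le> ?P (u m t)" if "m > q" "reaches p q (u m) (I m) t" for m t
    by (rule family_lower[OF p q dec u0 lt]) (use that in auto)
  have upper: "\<exists>k. (k \<longlongrightarrow> 1) at_top \<and> (\<forall>\<^sub>F m in at_top. \<forall>t>r0. reaches p q (u m) (I m) t \<longrightarrow>
      ?P (u m t) \<le> ?P (?a m) - ?c * k m * (t - r0))" if "r0 > 0" for r0
    by (rule family_upper[OF p q dec u0 lt that]) blast+
  have P0: "?P 0 = 0" if "q < p - 1"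
    using expo_less_1[OF p q] that by (auto simp: Psi_def)
  have Rlim: "(R \<longlongrightarrow> Rinf) at_top" if qp: "q < p - 1"
  proof (rule order_tendstoI)
    have Rinf: "?P 1 = ?c * Rinf"
      using limP[of Rinf] fbi[of Rinf] fbi(1)[of 0] P0 qp by simp
    show "\<forall>\<^sub>F m in at_top. x < R m" if "x < Rinf" for x
    proof -
      have "\<forall>\<^sub>F m in at_top. ?c * x < ?P (?a m)"
        using that c Rinf by (intro order_tendstoD(1)[OF Pa]) simp
      then show ?thesis
        using eventually_gt_at_top[of q]
      proof eventually_elim
        case (elim m)
        have R: "0 < R m" "u m (R m) = 0" using fb(1)[OF qp elim(2), of 0] fb(2)[OF qp elim(2), of "R m"] by auto
        have "?P (?a m) - ?c * R m \<le> 0"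
          using lower[OF elim(2) reach[OF elim(2) R(1) order_refl]] R(2) P0 qp by simp
        with elim(1) have "?c * x < ?c * R m" by linarith
        then show ?case using c by simp
      qed
    qed
    show "\<forall>\<^sub>F m in at_top. R m < x" if x: "Rinf < x" for x
    proof -
      \<comment> \<open>Half of the gap is spent on the delay near the maximum; at \<open>x\<close>
        the limiting upper line then still has the negative value
        \<open>- (?c * r0)\<close>.\<close>
      define r0 where "r0 = (x - Rinf) / 2"
      have "0 < Rinf" using fbi(1)[of 0] qp by simp
      have r0: "0 < r0" "r0 < x" using x \<open>0 < Rinf\<close> by (auto simp: r0_def field_simps)
      obtain k where k: "(k \<longlongrightarrow> 1) at_top" and up: "\<forall>\<^sub>F m in at_top. \<forall>t>r0. reaches p q (u m) (I m) t \<longrightarrow>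
          ?P (u m t) \<le> ?P (?a m) - ?c * k m * (t - r0)"
        using upper[OF r0(1)] by blast
      have "((\<lambda>m. ?P (?a m) - ?c * k m * (x - r0)) \<longlongrightarrow> ?P 1 - ?c * 1 * (x - r0)) at_top"
        by (intro tendsto_intros Pa k)
      moreover have "?P 1 - ?c * 1 * (x - r0) < 0"
      proof -
        have "?P 1 - ?c * 1 * (x - r0) = - (?c * r0)" by (simp add: Rinf r0_def field_simps)
        then show ?thesis using c r0 by simp
      qed
      ultimately have "\<forall>\<^sub>F m in at_top. ?P (?a m) - ?c * k m * (x - r0) < 0"
        by (rule order_tendstoD(2))
      moreover have "\<forall>\<^sub>F m in at_top. 0 < k m" by (rule order_tendstoD(1)[OF k]) simp
      ultimately show ?thesis
        using up eventually_gt_at_top[of q]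
      proof eventually_elim
        case (elim m)
        have R: "0 < R m" "u m (R m) = 0" using fb(1)[OF qp elim(4), of 0] fb(2)[OF qp elim(4), of "R m"] by auto
        show ?case
        proof (rule ccontr)
          assume "\<not> R m < x"
          then have "x \<le> R m" by simp
          then have "0 \<le> ?P (?a m) - ?c * k m * (R m - r0)"
            using elim(3)[rule_format, OF _ reach[OF elim(4) R(1) order_refl]] R(2) P0 qp r0 by simp
          also have "\<dots> \<le> ?P (?a m) - ?c * k m * (x - r0)"
            using \<open>x \<le> R m\<close> c elim(2) by (intro diff_left_mono mult_left_mono) auto
          finally show False using elim(1) by simp
        qed
      qed
    qed
  qed
  then show "q < p - 1 \<Longrightarrow> (R \<longlongrightarrow> Rinf) at_top" .
  show "((\<lambda>m. u m r) \<longlongrightarrow> uinf r) at_top" if r: "r > 0"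
  proof (rule order_tendstoI)
    fix y assume y: "uinf r < y"
    have dom: "uinf r \<in> Psi_dom p q"
      using r fbi[of r] uinf unfolding Psi_dom_def Prob_inf_def by auto
    \<comment> \<open>Past \<open>Rinf\<close> the explicit formula for the limit fails; there the
      line is negative while \<open>?P y\<close> is positive.\<close>
    have Py: "?P 1 - ?c * r < ?P y"
    proof (cases "q < p - 1 \<and> Rinf < r")
      case True
      then have "uinf r = 0" using fbi(2)[of r] r by simp
      then have "0 < ?P y" using mono[OF dom y] P0 True by simp
      moreover have "?P 1 - ?c * Rinf = 0"
        using limP[of Rinf] fbi[of Rinf] fbi(1)[of 0] P0 True by simp
      then have "?P 1 - ?c * r < 0" using True c by (smt (verit) mult_strict_left_mono)
      ultimately show ?thesis by simp
    next
      case False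
      then show ?thesis using limP[OF r] mono[OF dom y] by force
    qed
    \<comment> \<open>The second bound lets the delay use up at most half of the gap in
      \<open>Py\<close>; the first keeps \<open>r0 < r\<close>.\<close>
    define r0 where "r0 = min (r / 2) ((?P y - (?P 1 - ?c * r)) / (2 * ?c))"
    have r0: "0 < r0" "r0 < r" using r Py c by (auto simp: r0_def min_less_iff_disj)
    have "r0 \<le> (?P y - (?P 1 - ?c * r)) / (2 * ?c)" by (simp add: r0_def)
    then have "?c * r0 * 2 \<le> ?P y - (?P 1 - ?c * r)" using c by (simp add: field_simps)
    moreover have "?c * r0 > 0" using c r0 by simp
    ultimately have less: "?P 1 - ?c * 1 * (r - r0) < ?P y" by (simp add: right_diff_distrib)
    obtain k where k: "(k \<longlongrightarrow> 1) at_top" and up: "\<forall>\<^sub>F m in at_top. \<forall>t>r0. reaches p q (u m) (I m) t \<longrightarrow>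
        ?P (u m t) \<le> ?P (?a m) - ?c * k m * (t - r0)"
      using upper[OF r0(1)] by blast
    have "((\<lambda>m. ?P (?a m) - ?c * k m * (r - r0)) \<longlongrightarrow> ?P 1 - ?c * 1 * (r - r0)) at_top"
      by (intro tendsto_intros Pa k)
    then have "\<forall>\<^sub>F m in at_top. ?P (?a m) - ?c * k m * (r - r0) < ?P y"
      using less by (rule order_tendstoD(2))
    then show "\<forall>\<^sub>F m in at_top. u m r < y"
      using up eventually_gt_at_top[of q]
    proof eventually_elim
      case (elim m)
      have ydom: "y \<in> Psi_dom p q" using dom y by (auto simp: Psi_dom_def split: if_splits)
      show ?case
      proof (cases "q < p - 1 \<and> R m < r")
        case True
        then have "u m r = 0" using fb(2)[OF _ elim(3), of r] r by simp
        moreover have "0 < y" using y fbi(3)[of r] True r by simp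
        ultimately show ?thesis by simp
      next
        case False
        then have "reaches p q (u m) (I m) r" using reach[OF elim(3) r] by auto
        then have "?P (u m r) < ?P y" using elim(1,2) r0(2) by fastforce
        then show ?thesis using mono[OF ydom, of "u m r"] by (cases "u m r" y rule: linorder_cases) auto
      qed
    qed
  next
    fix y assume y: "y < uinf r"
    show "\<forall>\<^sub>F m in at_top. y < u m r"
    proof (cases "uinf r > 0")
      case False
      then have qp: "q < p - 1" using uinf r unfolding Prob_inf_def by (auto split: if_splits)
      have "y < 0" using y False by simp
      then have "y < u m r" if "m > q" for m
        using fb(3)[OF qp that, of r] r by simp
      then show ?thesis
        using eventually_gt_at_top[of q] by (rule eventually_mono[rotated])
    next
      case True
      \<comment> \<open>Raising \<open>y\<close> to a positive level below \<open>uinf r\<close>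
        puts it into the domain of \<open>Psi\<close> in every case.\<close>
      define z where "z = max y (uinf r / 2)"
      have z: "0 < z" "z < uinf r" "y \<le> z" using y True by (auto simp: z_def)
      have zdom: "z \<in> Psi_dom p q" using z by (auto simp: Psi_dom_def)
      \<comment> \<open>A positive limit at \<open>r\<close> means \<open>r < Rinf\<close>.
        Convergence of the free boundaries then gives \<open>r < R m\<close> for large
        \<open>m\<close>, where the lower line is available.\<close>
      have rR: "r < Rinf" if "q < p - 1" using fbi(2)[OF that, of r] r True by force
      have "?P z < ?P 1 - ?c * r" using mono[OF zdom z(2)] limP[OF r] rR by force
      moreover have "((\<lambda>m. ?P (?a m) - ?c * r) \<longlongrightarrow> ?P 1 - ?c * r) at_top"
        by (intro tendsto_intros Pa)
      ultimately have "\<forall>\<^sub>F m in at_top. ?P z < ?P (?a m) - ?c * r"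
        by (intro order_tendstoD(1))
      moreover have "\<forall>\<^sub>F m in at_top. q < p - 1 \<longrightarrow> r < R m"
        using order_tendstoD(1)[OF Rlim rR] by (cases "q < p - 1") auto
      ultimately show ?thesis
        using eventually_gt_at_top[of q]
      proof eventually_elim
        case (elim m)
        have rc: "reaches p q (u m) (I m) r" by (rule reach[OF elim(3) r]) (use elim(2) in simp)
        then have dom: "u m r \<in> Psi_dom p q" by (simp add: reaches_def[OF p q])
        have "?P z < ?P (u m r)" using lower[OF elim(3) rc] elim(1) by linarith
        then have "z < u m r" using mono[OF dom, of z] by (cases "u m r" z rule: linorder_cases) auto
        then show ?case using z by simp
      qed
    qed
  qed
qed

theorem theorem8p1:
  fixes p q :: real
    and u :: "real \<Rightarrow> real \<Rightarrow> real" and uinf :: "real \<Rightarrow> real"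
    and R :: "real \<Rightarrow> real" and Rinf :: real
  assumes p: "p > 1" and q: "q \<ge> 0"
    and u: "\<And>m. m > q \<Longrightarrow>
          antimono_on {0..} (u m) \<and> (if q < p - 1 then FBP p q m (u m) (R m) else Prob p q m (u m))"
    and uinf: "antimono_on {0..} uinf \<and> (if q < p - 1 then FBP_inf p q uinf Rinf else Prob_inf p q uinf)"
  shows "(\<forall>r>0. ((\<lambda>m. u m r) \<longlongrightarrow> uinf r) at_top) \<and>
         ((\<lambda>m. GN_const q m p) \<longlongrightarrow> GN_const_inf q p) at_top \<and>
         (q < p - 1 \<longrightarrow> (R \<longlongrightarrow> Rinf) at_top)"
  using solution_limits[OF p q u uinf] GN_const_tendsto[OF p q] by blast

end
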